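(* For every positive integer $k$, there are, up to isomorphism, only finitely many $k$-vertex-critical $(P_5,\text{gem})$-free graphs.
   Context: All graphs are finite and simple. $\chi(G)$ denotes the chromatic number of $G$. A graph $G$ is $k$-vertex-critical if $\chi(G)=k$ and $\chi(G-v)<k$ for all $v\in V(G)$. $P_n$ is the path on $n$ vertices; the gem is the graph on five vertices obtained from $P_4$ by adding a vertex adjacent to all four vertices of the path. A graph is $(P_5,\text{gem})$-free if it contains neither $P_5$ nor the gem as an induced subgraph. *)

theory Defs
  imports "Graph_Theory.Graph_Theory"
begin

text \<open>
  A finite simple graph is a \<open>pair_graph\<close>: a finite, loop-free, symmetric digraph without
  parallel arcs, each edge being represented by its two orientations.
\<close>

definition colorable :: "('a, 'b) pre_digraph \<Rightarrow> nat \<Rightarrow> bool" where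
  "colorable G k \<longleftrightarrow>
    (\<exists>c :: 'a \<Rightarrow> nat. c ` verts G \<subseteq> {..<k} \<and> (\<forall>(u, v) \<in> arcs_ends G. c u \<noteq> c v))"

text \<open>The least element exists for every finite loop-free graph (\<open>colorable_card\<close> below).\<close>

definition chromatic_number :: "('a, 'b) pre_digraph \<Rightarrow> nat" where
  "chromatic_number G = (LEAST k. colorable G k)"

definition vertex_critical :: "nat \<Rightarrow> ('a, 'b) pre_digraph \<Rightarrow> bool" where
  "vertex_critical k G \<longleftrightarrow>
    chromatic_number G = k \<and>
    (\<forall>v \<in> verts G. chromatic_number (pre_digraph.del_vert G v) < k)"

definition path_graph :: "nat \<Rightarrow> nat pair_pre_digraph" where
  "path_graph n =
    \<lparr>pverts = {..<n}, parcs = {(i, j). i < n \<and> j < n \<and> (j = Suc i \<or> i = Suc j)}\<rparr>"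

definition gem :: "nat pair_pre_digraph" where
  "gem = \<lparr>pverts = insert 4 (pverts (path_graph 4)),
    parcs = parcs (path_graph 4) \<union> {4} \<times> pverts (path_graph 4) \<union> pverts (path_graph 4) \<times> {4}\<rparr>"

definition contains_induced :: "('a, 'b) pre_digraph \<Rightarrow> ('c, 'd) pre_digraph \<Rightarrow> bool" where
  "contains_induced G F \<longleftrightarrow> (\<exists>H. induced_subgraph H G \<and> digraph_iso F H)"

definition P5_gem_free :: "'a pair_pre_digraph \<Rightarrow> bool" where
  "P5_gem_free G \<longleftrightarrow> \<not> contains_induced G (path_graph 5) \<and> \<not> contains_induced G gem"

text \<open>
  The quotient of a set of graphs by this relation is its set of isomorphism classes. With vertices
  in \<open>nat\<close>, every finite graph is represented.
\<close>

definition pair_graph_iso :: "('a pair_pre_digraph \<times> 'a pair_pre_digraph) set" where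
  "pair_graph_iso = {(G, H). pair_graph G \<and> pair_graph H \<and> digraph_iso G H}"

lemma colorable_card:
  assumes "digraph G"
  shows "colorable G (card (verts G))"
proof -
  interpret digraph G by fact
  obtain c where c: "bij_betw c (verts G) {..<card (verts G)}"
    using ex_bij_betw_finite_nat[OF finite_verts] by (auto simp: atLeast0LessThan)
  have "c u \<noteq> c v" if "(u, v) \<in> arcs_ends G" for u v
    using that c adj_not_same[of u] adj_in_verts by (auto simp: bij_betw_def dest: inj_onD)
  then show ?thesis
    using c unfolding colorable_def bij_betw_def by blast
qed

lemma pair_graph_path_graph: "pair_graph (path_graph n)"
proof -
  have "finite {(i, j). i < n \<and> j < n \<and> (j = Suc i \<or> i = Suc j)}"
    by (rule finite_subset[of _ "{..<n} \<times> {..<n}"]) auto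
  then show ?thesis
    by unfold_locales (auto simp: path_graph_def symmetric_def intro: symI)
qed

lemma pair_graph_gem: "pair_graph gem"
proof -
  interpret pair_graph "path_graph 4" by (rule pair_graph_path_graph)
  show ?thesis
    using pair_finite_arcs pair_sym_arcs
    by unfold_locales (auto simp: gem_def path_graph_def symmetric_def intro!: symI)
qed

text \<open>On simple graphs, library isomorphism is an adjacency-preserving bijection of the vertices.\<close>

lemma digraph_iso_pair_graph_iff:
  assumes "pair_graph G" "pair_graph H"
  shows "digraph_iso (with_proj G) (with_proj H) \<longleftrightarrow>
    (\<exists>f. bij_betw f (pverts G) (pverts H) \<and>
      (\<forall>u \<in> pverts G. \<forall>v \<in> pverts G. (u, v) \<in> parcs G \<longleftrightarrow> (f u, f v) \<in> parcs H))"
    (is "?L \<longleftrightarrow> ?R")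
proof -
  interpret G: pair_graph G by fact
  interpret H: pair_graph H by fact
  show ?thesis
  proof
    assume ?L
    then obtain h where h: "G.digraph_isomorphism h" "with_proj H = app_iso h (with_proj G)"
      by (auto simp: digraph_iso_def)
    have V: "pverts H = iso_verts h ` pverts G"
      using h(2) by (metis verts_app_iso with_proj_simps(1))
    have A: "parcs H = (\<lambda>(u, v). (iso_verts h u, iso_verts h v)) ` parcs G"
      using G.arcs_ends_app_iso_eq[OF h(1)] h(2) by (metis with_proj_simps(3))
    have I: "inj_on (iso_verts h) (pverts G)"
      using h(1) by (auto simp: G.digraph_isomorphism_def)
    have "(u, v) \<in> parcs G \<longleftrightarrow> (iso_verts h u, iso_verts h v) \<in> parcs H"
      if "u \<in> pverts G" "v \<in> pverts G" for u v
    proof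
      assume "(iso_verts h u, iso_verts h v) \<in> parcs H"
      then obtain x y where xy: "(x, y) \<in> parcs G"
        "iso_verts h u = iso_verts h x" "iso_verts h v = iso_verts h y"
        unfolding A by auto
      then have "x \<in> pverts G" "y \<in> pverts G"
        by (auto dest: G.in_arcsD1 G.in_arcsD2)
      then have "u = x" "v = y"
        using that I xy by (auto dest: inj_onD)
      then show "(u, v) \<in> parcs G" using xy by simp
    qed (auto simp: A)
    then show ?R using V I by (auto simp: bij_betw_def intro!: exI[of _ "iso_verts h"])
  next
    assume ?R
    then obtain f where f: "bij_betw f (pverts G) (pverts H)"
      "\<And>u v. u \<in> pverts G \<Longrightarrow> v \<in> pverts G \<Longrightarrow> (u, v) \<in> parcs G \<longleftrightarrow> (f u, f v) \<in> parcs H"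
      by blast
    define h where "h = \<lparr>iso_verts = f, iso_arcs = map_prod f f, iso_head = snd, iso_tail = fst\<rparr>"
    have I: "inj_on f (pverts G)" and V: "f ` pverts G = pverts H"
      using f(1) by (auto simp: bij_betw_def)
    have "parcs G \<subseteq> pverts G \<times> pverts G"
      by (auto dest: G.in_arcsD1 G.in_arcsD2)
    then have "inj_on (map_prod f f) (parcs G)"
      using inj_on_subset[OF map_prod_inj_on[OF I I]] by simp
    moreover have "parcs H = map_prod f f ` parcs G"
    proof (intro set_eqI iffI)
      fix e assume e: "e \<in> parcs H"
      then have "fst e \<in> f ` pverts G" "snd e \<in> f ` pverts G"
        unfolding V by (rule H.arc_fst_in_verts, rule H.arc_snd_in_verts)
      then obtain u v where uv: "u \<in> pverts G" "v \<in> pverts G" "e = map_prod f f (u, v)"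
        by (metis imageE map_prod_simp prod.collapse)
      then have "(u, v) \<in> parcs G" using e f(2)[of u v] by simp
      then show "e \<in> map_prod f f ` parcs G" using uv(3) by (rule rev_image_eqI)
    next
      fix e assume "e \<in> map_prod f f ` parcs G"
      then obtain u v where uv: "(u, v) \<in> parcs G" "e = (f u, f v)" by auto
      then show "e \<in> parcs H"
        using f(2)[OF G.in_arcsD1 G.in_arcsD2, OF uv(1) uv(1)] by simp
    qed
    ultimately have "pre_digraph.digraph_isomorphism (with_proj G) h"
      "with_proj H = app_iso h (with_proj G)"
      using I V G.pair_wf_digraph[folded wf_digraph_wp_iff]
      by (simp_all add: pre_digraph.digraph_isomorphism_def h_def app_iso_def with_proj_def)
    then show ?L unfolding digraph_iso_def by blast
  qed
qed

lemma equiv_pair_graph_iso: "equiv {G. pair_graph G} pair_graph_iso"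
proof (rule equivI)
  show "pair_graph_iso \<subseteq> {G. pair_graph G} \<times> {G. pair_graph G}"
    by (auto simp: pair_graph_iso_def)
  show "refl_on {G. pair_graph G} pair_graph_iso"
    by (auto simp: refl_on_def pair_graph_iso_def digraph_iso_pair_graph_iff intro!: exI[of _ id])
  show "sym pair_graph_iso"
    by (auto simp: pair_graph_iso_def wf_digraph_wp_iff pair_graph_def pair_digraph.pair_wf_digraph
        intro!: symI digraph_iso_swap)
  show "trans pair_graph_iso"
    by (auto simp: pair_graph_iso_def intro!: transI intro: digraph_iso_trans)
qed

end

theory Submission
  imports Defs "HOL-Library.Ramsey"
begin

text \<open>
  In a \<open>k\<close>-vertex-critical \<open>(P\<^sub>5, gem)\<close>-free graph every neighbourhood \<open>N(d)\<close> is \<open>P\<^sub>4\<close>-free, so by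
  Seinsche's theorem the components of a module of \<open>N(d)\<close> are single vertices or joins of two modules
  with smaller clique number. By induction on the clique number it therefore suffices to bound the
  number of components of bounded size. If there are too many, take them labelled and isomorphic.
  Criticality forbids mapping one component onto another one with a larger outer neighbourhood,
  which provides for each ordered pair of components a witness outside \<open>N(d)\<close>. Since \<open>P\<^sub>5\<close> is
  excluded, witnesses with crossing traces are adjacent and a witness is mixed on at most one
  component; since cliques are bounded, Ramsey's theorem leaves only witnesses attached to initial
  segments for one orientation of the pairs and to final segments for the other, and these create a gem.
  So degrees are bounded, and a connected \<open>P\<^sub>5\<close>-free graph has diameter at most three.
\<close>

section \<open>Ramsey's theorem for colourings by an arbitrary finite set\<close>

text \<open>The library theorem colours by numbers, so \<open>h\<close> renames the elements of
  \<open>C\<close>. The homogeneous set is listed increasingly because the colourings used below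
  depend on the order of their arguments.\<close>

lemma ramsey_enumeration:
  fixes r N :: nat
  assumes "finite C"
  shows "\<exists>n. \<forall>f :: nat set \<Rightarrow> 'c. f ` nsets {..<n} r \<subseteq> C \<longrightarrow>
    (\<exists>e c. (\<forall>i j. i < j \<longrightarrow> j < N \<longrightarrow> e i < e j) \<and> (\<forall>i<N. e i < n) \<and>
      (\<forall>X \<in> nsets {..<N} r. f (e ` X) = c))"
proof -
  obtain h where h: "bij_betw h C {..<card C}"
    using ex_bij_betw_finite_nat[OF assms] by (auto simp: atLeast0LessThan)
  obtain n :: nat where n: "partn_lst {..<n} (replicate (card C) N) r"
    using ramsey_full[of "replicate (card C) N" r] by blast
  have "\<exists>e c. (\<forall>i j. i < j \<longrightarrow> j < N \<longrightarrow> e i < e j) \<and> (\<forall>i<N. e i < n) \<and>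
      (\<forall>X \<in> nsets {..<N} r. f (e ` X) = c)"
    if f: "f ` nsets {..<n} r \<subseteq> C" for f :: "nat set \<Rightarrow> 'c"
  proof -
    have "(\<lambda>X. h (f X)) \<in> nsets {..<n} r \<rightarrow> {..<card C}"
      using f h by (auto simp: bij_betw_def)
    then obtain i H where i: "i < card C" and H0: "H \<in> nsets {..<n} (replicate (card C) N ! i)"
      and hom: "(\<lambda>X. h (f X)) ` nsets H r \<subseteq> {i}"
      using partn_lstE[OF n, of "\<lambda>X. h (f X)" "card C"] by auto
    from H0 i have H: "H \<subseteq> {..<n}" "finite H" "card H = N"
      by (auto simp: nsets_def)
    define e where "e = (\<lambda>i. sorted_list_of_set H ! i)"
    have len: "length (sorted_list_of_set H) = N" and set: "set (sorted_list_of_set H) = H"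
      using H by auto
    have mono: "e i < e j" if "i < j" "j < N" for i j
      using that len strict_sorted_list_of_set[of H] sorted_wrt_nth_less[of "(<)" "sorted_list_of_set H" i j]
      unfolding e_def by auto
    have eH: "e i \<in> H" if "i < N" for i
      using that len set nth_mem unfolding e_def by metis
    have "f (e ` X) = inv_into C h i" if X: "X \<in> nsets {..<N} r" for X
    proof -
      have "inj_on e {..<N}"
        using mono by (intro linorder_inj_onI) (force, auto)
      then have "card (e ` X) = r" "e ` X \<subseteq> H" "finite X"
        using X eH by (auto simp: nsets_def card_image inj_on_subset)
      then have *: "e ` X \<in> nsets H r" by (auto simp: nsets_def)
      then have "f (e ` X) \<in> C" using f H(1) nsets_mono by blast
      moreover have "h (f (e ` X)) = i" using hom * by auto
      ultimately show ?thesis using h by (metis bij_betw_inv_into_left)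
    qed
    then show ?thesis using mono eH H(1) by blast
  qed
  then show ?thesis by blast
qed

text \<open>The pigeonhole principle, as the case of one-element sets.\<close>

lemma ramsey_points:
  fixes N :: nat
  assumes "finite C"
  shows "\<exists>n. \<forall>F :: nat \<Rightarrow> 'c. (\<forall>i<n. F i \<in> C) \<longrightarrow>
    (\<exists>e c. (\<forall>i j. i < j \<longrightarrow> j < N \<longrightarrow> e i < e j) \<and> (\<forall>i<N. e i < n \<and> F (e i) = c))"
proof -
  obtain n where n: "\<forall>f :: nat set \<Rightarrow> 'c. f ` nsets {..<n} 1 \<subseteq> C \<longrightarrow>
    (\<exists>e c. (\<forall>i j. i < j \<longrightarrow> j < N \<longrightarrow> e i < e j) \<and> (\<forall>i<N. e i < n) \<and>
      (\<forall>X \<in> nsets {..<N} 1. f (e ` X) = c))"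
    using ramsey_enumeration[OF assms, of 1 N] ..
  show ?thesis
  proof (intro exI[of _ n] allI impI)
    fix F :: "nat \<Rightarrow> 'c" assume F: "\<forall>i<n. F i \<in> C"
    then have "(\<lambda>X. F (Min X)) ` nsets {..<n} 1 \<subseteq> C"
      by (auto simp: nsets_one)
    from n[rule_format, OF this] obtain e c where e: "\<forall>i j. i < j \<longrightarrow> j < N \<longrightarrow> e i < e j" "\<forall>i<N. e i < n"
      "\<forall>X \<in> nsets {..<N} 1. F (Min (e ` X)) = c" by blast
    have "\<forall>i<N. F (e i) = c"
      using e(3) by (auto simp: nsets_one)
    with e show "\<exists>e c. (\<forall>i j. i < j \<longrightarrow> j < N \<longrightarrow> e i < e j) \<and> (\<forall>i<N. e i < n \<and> F (e i) = c)"
      by blast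
  qed
qed

text \<open>A function of \<open>i < j\<close> is a colouring of two-element sets, read off through
  \<open>Min\<close> and \<open>Max\<close>. For \<open>N\<close> below 2 nothing ties the colour
  \<open>c\<close> to \<open>C\<close>.\<close>

lemma ramsey_pairs:
  fixes N :: nat
  assumes "finite C"
  shows "\<exists>n. \<forall>F :: nat \<Rightarrow> nat \<Rightarrow> 'c. (\<forall>i j. i < j \<longrightarrow> j < n \<longrightarrow> F i j \<in> C) \<longrightarrow>
    (\<exists>e c. (\<forall>i j. i < j \<longrightarrow> j < N \<longrightarrow> e i < e j \<and> F (e i) (e j) = c) \<and> (\<forall>i<N. e i < n))"
proof -
  obtain n where n: "\<forall>f :: nat set \<Rightarrow> 'c. f ` nsets {..<n} 2 \<subseteq> C \<longrightarrow>
    (\<exists>e c. (\<forall>i j. i < j \<longrightarrow> j < N \<longrightarrow> e i < e j) \<and> (\<forall>i<N. e i < n) \<and>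
      (\<forall>X \<in> nsets {..<N} 2. f (e ` X) = c))"
    using ramsey_enumeration[OF assms, of 2 N] ..
  show ?thesis
  proof (intro exI[of _ n] allI impI)
    fix F :: "nat \<Rightarrow> nat \<Rightarrow> 'c" assume F: "\<forall>i j. i < j \<longrightarrow> j < n \<longrightarrow> F i j \<in> C"
    define f where "f X = F (Min X) (Max X)" for X
    have f: "f {i, j} = F i j" if "i < j" for i j
      using that by (simp add: f_def)
    have "f ` nsets {..<n} 2 \<subseteq> C"
      using F by (auto simp: ordered_nsets_2_eq f)
    from n[rule_format, OF this] obtain e c where e: "\<And>i j. i < j \<Longrightarrow> j < N \<Longrightarrow> e i < e j"
      "\<And>i. i < N \<Longrightarrow> e i < n" "\<And>X. X \<in> nsets {..<N} 2 \<Longrightarrow> f (e ` X) = c" by blast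
    have "F (e i) (e j) = c" if "i < j" "j < N" for i j
      using e(3)[of "{i, j}"] f[OF e(1)[OF that]] that by auto
    with e show "\<exists>e c. (\<forall>i j. i < j \<longrightarrow> j < N \<longrightarrow> e i < e j \<and> F (e i) (e j) = c) \<and> (\<forall>i<N. e i < n)"
      by (intro exI[of _ e] exI[of _ c]) simp
  qed
qed

lemma ramsey_triples:
  fixes N :: nat
  assumes "finite C"
  shows "\<exists>n. \<forall>F :: nat \<Rightarrow> nat \<Rightarrow> nat \<Rightarrow> 'c.
    (\<forall>i j l. i < j \<longrightarrow> j < l \<longrightarrow> l < n \<longrightarrow> F i j l \<in> C) \<longrightarrow>
    (\<exists>e c. (\<forall>i j. i < j \<longrightarrow> j < N \<longrightarrow> e i < e j) \<and> (\<forall>i<N. e i < n) \<and>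
      (\<forall>i j l. i < j \<longrightarrow> j < l \<longrightarrow> l < N \<longrightarrow> F (e i) (e j) (e l) = c))"
proof -
  obtain n where n: "\<forall>f :: nat set \<Rightarrow> 'c. f ` nsets {..<n} 3 \<subseteq> C \<longrightarrow>
    (\<exists>e c. (\<forall>i j. i < j \<longrightarrow> j < N \<longrightarrow> e i < e j) \<and> (\<forall>i<N. e i < n) \<and>
      (\<forall>X \<in> nsets {..<N} 3. f (e ` X) = c))"
    using ramsey_enumeration[OF assms, of 3 N] ..
  show ?thesis
  proof (intro exI[of _ n] allI impI)
    fix F :: "nat \<Rightarrow> nat \<Rightarrow> nat \<Rightarrow> 'c"
    assume F: "\<forall>i j l. i < j \<longrightarrow> j < l \<longrightarrow> l < n \<longrightarrow> F i j l \<in> C"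
    \<comment> \<open>The middle one of three elements is the maximum of what remains without
      \<open>Max X\<close>.\<close>
    define f where "f X = F (Min X) (Max (X - {Max X})) (Max X)" for X
    have f: "f {i, j, l} = F i j l" if "i < j" "j < l" for i j l
    proof -
      have "{i, j, l} - {l} = {i, j}" using that by auto
      then show ?thesis using that by (simp add: f_def)
    qed
    have "f ` nsets {..<n} 3 \<subseteq> C"
      using F by (auto simp: ordered_nsets_3_eq f)
    from n[rule_format, OF this] obtain e c where e: "\<And>i j. i < j \<Longrightarrow> j < N \<Longrightarrow> e i < e j"
      "\<And>i. i < N \<Longrightarrow> e i < n" "\<And>X. X \<in> nsets {..<N} 3 \<Longrightarrow> f (e ` X) = c" by blast
    have "F (e i) (e j) (e l) = c" if "i < j" "j < l" "l < N" for i j l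
      using e(3)[of "{i, j, l}"] f[OF e(1) e(1), of i j l] that by (auto simp: nsets_def)
    with e show "\<exists>e c. (\<forall>i j. i < j \<longrightarrow> j < N \<longrightarrow> e i < e j) \<and> (\<forall>i<N. e i < n) \<and>
      (\<forall>i j l. i < j \<longrightarrow> j < l \<longrightarrow> l < N \<longrightarrow> F (e i) (e j) (e l) = c)"
      by (intro exI[of _ e] exI[of _ c]) simp
  qed
qed

section \<open>Connectedness and \<open>P\<^sub>4\<close>-free graphs\<close>

text \<open>Phrased with bipartitions, so that connectedness of the complement has the same form.\<close>

definition conn :: "('a \<Rightarrow> 'a \<Rightarrow> bool) \<Rightarrow> 'a set \<Rightarrow> bool" where
  "conn E Q \<longleftrightarrow> Q \<noteq> {} \<and>
    (\<forall>A B. A \<union> B = Q \<longrightarrow> A \<inter> B = {} \<longrightarrow> A \<noteq> {} \<longrightarrow> B \<noteq> {} \<longrightarrow> (\<exists>a\<in>A. \<exists>b\<in>B. E a b))"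

text \<open>\<open>conn\<close> is applied to the part of \<open>Q\<close> where \<open>P\<close>
  holds and to the rest. This replaces arguments along paths.\<close>

lemma conn_boundary_edge:
  assumes "conn E Q" "q \<in> Q" "P q" "q' \<in> Q" "\<not> P q'"
  obtains u v where "u \<in> Q" "v \<in> Q" "P u" "\<not> P v" "E u v"
proof -
  have "{u\<in>Q. P u} \<union> {u\<in>Q. \<not> P u} = Q" "{u\<in>Q. P u} \<inter> {u\<in>Q. \<not> P u} = {}"
    "{u\<in>Q. P u} \<noteq> {}" "{u\<in>Q. \<not> P u} \<noteq> {}"
    using assms by auto
  then have "\<exists>a\<in>{u\<in>Q. P u}. \<exists>b\<in>{u\<in>Q. \<not> P u}. E a b"
    using assms(1) unfolding conn_def by blast
  then show ?thesis using that by blast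
qed

text \<open>A disconnected set splits along a bipartition without edges, and both sides are split
  further. As every member satisfies \<open>conn\<close>, none is empty.\<close>

lemma components_exist:
  assumes "finite W" "symp E"
  shows "\<exists>\<C>. \<Union>\<C> = W \<and> (\<forall>Q\<in>\<C>. conn E Q) \<and>
    (\<forall>Q\<in>\<C>. \<forall>R\<in>\<C>. Q \<noteq> R \<longrightarrow> Q \<inter> R = {} \<and> (\<forall>q\<in>Q. \<forall>r\<in>R. \<not> E q r))"
  using assms(1)
proof (induction W rule: finite_psubset_induct)
  case (psubset W)
  show ?case
  proof (cases "W = {} \<or> conn E W")
    case True
    then show ?thesis
    proof
      assume "W = {}" then show ?thesis by (intro exI[of _ "{}"]) auto
    next
      assume "conn E W" then show ?thesis by (intro exI[of _ "{W}"]) auto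
    qed
  next
    case False
    then obtain A B where AB: "A \<union> B = W" "A \<inter> B = {}" "A \<noteq> {}" "B \<noteq> {}"
      "\<And>a b. a \<in> A \<Longrightarrow> b \<in> B \<Longrightarrow> \<not> E a b"
      unfolding conn_def by blast
    then have "A \<subset> W" "B \<subset> W" by auto
    obtain \<A> where A: "\<Union>\<A> = A \<and> (\<forall>Q\<in>\<A>. conn E Q) \<and>
      (\<forall>Q\<in>\<A>. \<forall>R\<in>\<A>. Q \<noteq> R \<longrightarrow> Q \<inter> R = {} \<and> (\<forall>q\<in>Q. \<forall>r\<in>R. \<not> E q r))"
      using psubset.IH[OF \<open>A \<subset> W\<close>] ..
    obtain \<B> where B: "\<Union>\<B> = B \<and> (\<forall>Q\<in>\<B>. conn E Q) \<and>
      (\<forall>Q\<in>\<B>. \<forall>R\<in>\<B>. Q \<noteq> R \<longrightarrow> Q \<inter> R = {} \<and> (\<forall>q\<in>Q. \<forall>r\<in>R. \<not> E q r))"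
      using psubset.IH[OF \<open>B \<subset> W\<close>] ..
    have cross: "Q \<inter> R = {} \<and> (\<forall>q\<in>Q. \<forall>r\<in>R. \<not> E q r \<and> \<not> E r q)" if "Q \<in> \<A>" "R \<in> \<B>" for Q R
    proof -
      have "Q \<subseteq> A" "R \<subseteq> B" using that conjunct1[OF A] conjunct1[OF B] by auto
      then show ?thesis using AB(2,5) sympD[OF assms(2)] by blast
    qed
    have sep: "Q \<inter> R = {} \<and> (\<forall>q\<in>Q. \<forall>r\<in>R. \<not> E q r)"
      if QR: "Q \<in> \<A> \<union> \<B>" "R \<in> \<A> \<union> \<B>" "Q \<noteq> R" for Q R
    proof (cases "Q \<in> \<A>"; cases "R \<in> \<A>")
      assume "Q \<in> \<A>" "R \<in> \<A>" then show ?thesis using A QR(3) by simp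
    next
      assume "Q \<in> \<A>" "R \<notin> \<A>" then show ?thesis using cross[of Q R] QR by simp
    next
      assume "Q \<notin> \<A>" "R \<in> \<A>" then show ?thesis using cross[of R Q] QR by (auto simp: inf_commute)
    next
      assume "Q \<notin> \<A>" "R \<notin> \<A>" then show ?thesis using B QR by simp
    qed
    moreover have "\<Union> (\<A> \<union> \<B>) = W" using A B AB(1) by (simp add: Union_Un_distrib)
    moreover have "\<forall>Q \<in> \<A> \<union> \<B>. conn E Q" using A B by blast
    ultimately show ?thesis by (intro exI[of _ "\<A> \<union> \<B>"]) simp
  qed
qed

section \<open>Seinsche's theorem on \<open>P\<^sub>4\<close>-free graphs\<close>

text \<open>The component \<open>C\<close> of \<open>y\<close> contains a neighbour and a
  non-neighbour of \<open>v\<close>, hence an edge \<open>x z\<close> with only \<open>x\<close>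
  adjacent to \<open>v\<close>; a neighbour \<open>w\<close> of \<open>v\<close> outside
  \<open>C\<close> completes the path \<open>z\<close>, \<open>x\<close>, \<open>v\<close>,
  \<open>w\<close>. The inequalities serve the use in the complement, where a non-edge means
  equality or adjacency.\<close>

lemma P4_if_disconnected_by_deletion:
  assumes "finite Q" "symp E" "v \<notin> Q" "Q \<noteq> {}" "\<not> conn E Q" "conn E (insert v Q)"
    and y: "y \<in> Q" "\<not> E v y"
  obtains z x w where "z \<in> Q" "x \<in> Q" "w \<in> Q" "E z x" "E x v" "E v w"
    "\<not> E z v" "\<not> E z w" "\<not> E x w" "z \<noteq> w" "x \<noteq> w"
proof -
  have sym: "E a b \<Longrightarrow> E b a" for a b using assms(2) by (rule sympD)
  obtain \<C> where \<C>: "\<Union>\<C> = Q" "\<And>R. R \<in> \<C> \<Longrightarrow> conn E R"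
    "\<And>R S. R \<in> \<C> \<Longrightarrow> S \<in> \<C> \<Longrightarrow> R \<noteq> S \<Longrightarrow> R \<inter> S = {} \<and> (\<forall>q\<in>R. \<forall>r\<in>S. \<not> E q r)"
    using components_exist[OF assms(1,2)] by metis
  obtain C where C: "C \<in> \<C>" "y \<in> C" using y(1) \<C>(1) by auto
  have "C \<noteq> Q" using \<C>(2) C assms(5) by blast
  moreover have "C \<subseteq> Q" using C \<C>(1) by auto
  ultimately obtain y' where y': "y' \<in> Q" "y' \<notin> C" by auto
  have sep: "\<not> E q r \<and> \<not> E r q" if "q \<in> C" "r \<in> Q" "r \<notin> C" for q r
    using that \<C>(1,3) C(1) sym by blast
  \<comment> \<open>An edge leaving the component \<open>C\<close> can only end in
    \<open>v\<close>.\<close>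
  obtain a b where "a \<in> insert v Q" "b \<in> insert v Q" "a \<in> C" "b \<notin> C" "E a b"
    using conn_boundary_edge[OF assms(6), where P = "\<lambda>u. u \<in> C"] C(2) y' y(1) by (metis insertCI)
  then have a: "a \<in> C" "E v a" using sep sym by auto
  \<comment> \<open>Likewise an edge from outside into \<open>insert v C\<close> can only end in
    \<open>v\<close>.\<close>
  obtain w u where "w \<in> insert v Q" "u \<in> insert v Q" "w \<notin> insert v C" "u \<in> insert v C" "E w u"
    using conn_boundary_edge[OF assms(6), where P = "\<lambda>u. u \<notin> insert v C"] y' assms(3)
    by (metis insertCI insertE)
  then have w: "w \<in> Q" "w \<notin> C" "E v w" using sep sym \<open>C \<subseteq> Q\<close> by auto
  obtain x z where "x \<in> C" "z \<in> C" "E v x" "\<not> E v z" "E x z"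
    using conn_boundary_edge[OF \<C>(2)[OF C(1)], where P = "E v"] a C(2) y(2) by metis
  then show ?thesis
    using that[of z x w] w sep \<open>C \<subseteq> Q\<close> sym by blast
qed

text \<open>Seinsche's theorem. Deleting a vertex leaves a graph that is disconnected or whose complement
  is; the two cases are exchanged by complementation, which preserves \<open>P\<^sub>4\<close>.\<close>

lemma P4_free_not_conn_and_co_conn:
  assumes "finite Q" "symp E" "irreflp E" "card Q \<ge> 2"
    and "\<And>a b c d. \<lbrakk>a \<in> Q; b \<in> Q; c \<in> Q; d \<in> Q; E a b; E b c; E c d; \<not> E a c; \<not> E a d; \<not> E b d\<rbrakk> \<Longrightarrow> False"
  shows "\<not> conn E Q \<or> \<not> conn (\<lambda>x y. x \<noteq> y \<and> \<not> E x y) Q"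
  using assms(1,4,5)
proof (induction Q rule: finite_induct)
  case empty then show ?case by simp
next
  case (insert v Q)
  let ?co = "\<lambda>x y. x \<noteq> y \<and> \<not> E x y"
  have sym: "E a b \<Longrightarrow> E b a" for a b using assms(2) by (rule sympD)
  have co: "symp ?co" using sym by (auto intro: sympI)
  have P4: False if "a \<in> insert v Q" "b \<in> insert v Q" "c \<in> insert v Q" "d \<in> insert v Q"
    "E a b" "E b c" "E c d" "\<not> E a c" "\<not> E a d" "\<not> E b d" for a b c d
    using insert.prems(2) that by blast
  show ?case
  proof (rule ccontr)
    assume "\<not> ?case"
    then have c: "conn E (insert v Q)" and cc: "conn ?co (insert v Q)" by auto
    have ne: "Q \<noteq> {}" using insert.prems(1) insert.hyps by auto
    then obtain q where q: "q \<in> Q" by auto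
    obtain y where y: "y \<in> Q" "\<not> E v y"
      using conn_boundary_edge[OF cc, where P = "\<lambda>u. u = v" and q = v and q' = q] q insert.hyps(2)
      by (metis insertE insertCI)
    obtain y' where y': "y' \<in> Q" "E v y'"
      using conn_boundary_edge[OF c, where P = "\<lambda>u. u = v" and q = v and q' = q] q insert.hyps(2)
      by (metis insertE insertCI)
    \<comment> \<open>\<open>Q\<close> contains both a neighbour and a non-neighbour of
      \<open>v\<close>, so it is no singleton.\<close>
    have "card Q \<ge> 2"
    proof (rule ccontr)
      assume "\<not> card Q \<ge> 2"
      then have "card Q = 1" using ne insert.hyps(1) by (metis One_nat_def card_gt_0_iff less_2_cases nat_neq_iff not_le)
      then show False using y y' by (metis card_1_singletonE singletonD)
    qed
    then have "\<not> conn E Q \<or> \<not> conn ?co Q"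
      using insert.IH P4 by blast
    then show False
    proof
      assume "\<not> conn E Q"
      then obtain z x w where "z \<in> Q" "x \<in> Q" "w \<in> Q" "E z x" "E x v" "E v w"
        "\<not> E z v" "\<not> E z w" "\<not> E x w"
        using P4_if_disconnected_by_deletion[OF insert.hyps(1) assms(2) insert.hyps(2) ne _ c y] by metis
      then show False
        using P4[of z x v w] by blast
    next
      assume "\<not> conn ?co Q"
      then obtain z x w where "z \<in> Q" "x \<in> Q" "w \<in> Q" "?co z x" "?co x v" "?co v w"
        "\<not> ?co z v" "\<not> ?co z w" "\<not> ?co x w" "z \<noteq> w" "x \<noteq> w"
        using P4_if_disconnected_by_deletion[OF insert.hyps(1) co insert.hyps(2) ne _ cc y'(1)] y'(2)
        by (metis (no_types, lifting))
      \<comment> \<open>The complement of the path \<open>z\<close>, \<open>x\<close>,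
        \<open>v\<close>, \<open>w\<close> is the path \<open>v\<close>, \<open>z\<close>,
        \<open>w\<close>, \<open>x\<close>.\<close>
      then show False
        using P4[of v z w x] sym insert.hyps(2) by blast
    qed
  qed
qed

text \<open>A bipartition that disconnects the complement is a complete join in
  \<open>E\<close>.\<close>

lemma P4_free_conn_join:
  assumes "finite Q" "symp E" "irreflp E" "card Q \<ge> 2" "conn E Q"
    and "\<And>a b c d. \<lbrakk>a \<in> Q; b \<in> Q; c \<in> Q; d \<in> Q; E a b; E b c; E c d; \<not> E a c; \<not> E a d; \<not> E b d\<rbrakk> \<Longrightarrow> False"
  obtains A B where "A \<union> B = Q" "A \<inter> B = {}" "A \<noteq> {}" "B \<noteq> {}" "\<And>a b. a \<in> A \<Longrightarrow> b \<in> B \<Longrightarrow> E a b"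
proof -
  have "\<not> conn E Q \<or> \<not> conn (\<lambda>x y. x \<noteq> y \<and> \<not> E x y) Q"
    by (rule P4_free_not_conn_and_co_conn[OF assms(1-4)]) (fact assms(6))
  moreover have "Q \<noteq> {}" using assms(5) by (simp add: conn_def)
  ultimately have "Q \<noteq> {}" "\<not> conn (\<lambda>x y. x \<noteq> y \<and> \<not> E x y) Q"
    using assms(5) by simp_all
  then obtain A B where "A \<union> B = Q" "A \<inter> B = {}" "A \<noteq> {}" "B \<noteq> {}"
    "\<And>a b. a \<in> A \<Longrightarrow> b \<in> B \<Longrightarrow> a = b \<or> E a b"
    unfolding conn_def by blast
  then show ?thesis using that[of A B] by blast
qed

section \<open>Homogeneous families of components in a neighbourhood\<close>

text \<open>The last axiom is where criticality enters: a colouring of \<open>V - A\<close> would extend along \<open>f\<close>.\<close>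

locale critical_graph =
  fixes k :: nat and V :: "'a set" and E :: "'a \<Rightarrow> 'a \<Rightarrow> bool"
  assumes finite_V: "finite V"
    and E_in_V: "E x y \<Longrightarrow> x \<in> V"
    and E_sym: "E x y \<Longrightarrow> E y x"
    and E_irrefl: "\<not> E x x"
    and no_P5: "\<lbrakk>E p q; E q r; E r s; E s t; \<not> E p r; \<not> E p s; \<not> E p t; \<not> E q s; \<not> E q t; \<not> E r t\<rbrakk> \<Longrightarrow> False"
    and no_gem: "\<lbrakk>E z p; E z q; E z r; E z s; E p q; E q r; E r s; \<not> E p r; \<not> E p s; \<not> E q s\<rbrakk> \<Longrightarrow> False"
    and card_clique: "\<lbrakk>K \<subseteq> V; \<And>x y. \<lbrakk>x \<in> K; y \<in> K; x \<noteq> y\<rbrakk> \<Longrightarrow> E x y\<rbrakk> \<Longrightarrow> card K \<le> k"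
    and connected: "\<lbrakk>A \<union> B = V; A \<inter> B = {}; A \<noteq> {}; B \<noteq> {}\<rbrakk> \<Longrightarrow> \<exists>a\<in>A. \<exists>b\<in>B. E a b"
    and hom_not_dominating: "\<lbrakk>A \<subseteq> V; A \<noteq> {}; f ` A \<subseteq> V - A;
      \<And>a b. \<lbrakk>a \<in> A; b \<in> A; E a b\<rbrakk> \<Longrightarrow> E (f a) (f b)\<rbrakk> \<Longrightarrow> \<exists>a\<in>A. \<exists>z. z \<notin> A \<and> E a z \<and> \<not> E (f a) z"
begin

section \<open>Cliques, mixed vertices and crossing traces\<close>

lemma E_in_V': "E x y \<Longrightarrow> y \<in> V"
  using E_in_V E_sym by blast

text \<open>Adjacency along \<open>i < j\<close> already forces injectivity, so \<open>k + 1\<close>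
  such vertices exceed the clique bound. This refutes long families of pairwise adjacent
  witnesses.\<close>

lemma no_clique_sequence:
  assumes "\<And>i. i \<le> k \<Longrightarrow> f i \<in> V" "\<And>i j. i < j \<Longrightarrow> j \<le> k \<Longrightarrow> E (f i) (f j)"
  shows False
proof -
  have "inj_on f {..k}"
    using assms(2) E_irrefl by (intro linorder_inj_onI) (force, auto)
  then have "card (f ` {..k}) = k + 1" by (simp add: card_image)
  moreover have "E x y" if "x \<in> f ` {..k}" "y \<in> f ` {..k}" "x \<noteq> y" for x y
  proof -
    obtain i j where ij: "x = f i" "y = f j" "i \<le> k" "j \<le> k" using \<open>x \<in> _\<close> \<open>y \<in> _\<close> by auto
    then have "i < j \<or> j < i" using \<open>x \<noteq> y\<close> by (metis nat_neq_iff)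
    then show ?thesis using assms(2) E_sym ij by blast
  qed
  ultimately show False
    using card_clique[of "f ` {..k}"] assms(1) by force
qed

text \<open>Connectedness yields edges \<open>u v\<close> in \<open>Q\<close> and
  \<open>u' v'\<close> in \<open>R\<close> with \<open>x\<close> adjacent to \<open>u\<close> and
  \<open>u'\<close> only; then \<open>v\<close>, \<open>u\<close>, \<open>x\<close>,
  \<open>u'\<close>, \<open>v'\<close> is an induced \<open>P\<^sub>5\<close>.\<close>

lemma mixed_on_at_most_one:
  assumes "conn E Q" "conn E R" "\<And>q r. q \<in> Q \<Longrightarrow> r \<in> R \<Longrightarrow> \<not> E q r"
    and "q \<in> Q" "E x q" "q' \<in> Q" "\<not> E x q'" "r \<in> R" "E x r" "r' \<in> R" "\<not> E x r'"
  shows False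
proof -
  obtain u v where "u \<in> Q" "v \<in> Q" "E x u" "\<not> E x v" "E u v"
    using conn_boundary_edge[OF assms(1), where P = "E x"] assms(4-7) by metis
  moreover obtain u' v' where "u' \<in> R" "v' \<in> R" "E x u'" "\<not> E x v'" "E u' v'"
    using conn_boundary_edge[OF assms(2), where P = "E x"] assms(8-11) by metis
  ultimately show False
    using no_P5[of v u x u' v'] assms(3) E_sym by metis
qed

text \<open>Otherwise \<open>x\<close>, \<open>s\<close>, \<open>d\<close>, \<open>s'\<close>,
  \<open>y\<close> is an induced \<open>P\<^sub>5\<close>.\<close>

lemma crossing_imp_adjacent:
  assumes "E d s" "E d s'" "\<not> E s s'" "\<not> E d x" "\<not> E d y"
    and "E x s" "\<not> E x s'" "E y s'" "\<not> E y s"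
  shows "E x y"
  using no_P5[of x s d s' y] assms E_sym by metis

text \<open>If both bits agree, the witnesses of consecutive pairs cross; if late vertices are adjacent
  and early ones are not, the witnesses of nested pairs cross. Either way they form a clique.\<close>

lemma homogeneous_witnesses_prefix:
  assumes s: "\<And>i. i < 2 * k + 2 \<Longrightarrow> E d (s i)"
    "\<And>i j. i < j \<Longrightarrow> j < 2 * k + 2 \<Longrightarrow> \<not> E (s i) (s j)"
    and x: "\<And>i j. i < j \<Longrightarrow> j < 2 * k + 2 \<Longrightarrow> \<not> E d (x i j) \<and> E (x i j) (s i) \<and> \<not> E (x i j) (s j)"
    and late: "\<And>i j l. i < j \<Longrightarrow> j < l \<Longrightarrow> l < 2 * k + 2 \<Longrightarrow> E (x i j) (s l) \<longleftrightarrow> \<alpha>"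
    and early: "\<And>i j l. i < j \<Longrightarrow> j < l \<Longrightarrow> l < 2 * k + 2 \<Longrightarrow> E (x j l) (s i) \<longleftrightarrow> \<beta>"
  shows "\<not> \<alpha> \<and> \<beta>"
proof -
  have cross: "E p q" if "\<not> E d p" "\<not> E d q" "i < 2 * k + 2" "j < 2 * k + 2" "i \<noteq> j"
    "E p (s i)" "\<not> E p (s j)" "E q (s j)" "\<not> E q (s i)" for p q i j
  proof -
    have "\<not> E (s i) (s j)" using s(2) E_sym that(3-5) by (metis nat_neq_iff)
    then show ?thesis using crossing_imp_adjacent[of d "s i" "s j" p q] s(1) that by blast
  qed
  have "\<alpha> \<noteq> \<beta>"
  proof
    assume eq: "\<alpha> = \<beta>"
    show False
    proof (rule no_clique_sequence[of "\<lambda>t. x (2 * t) (2 * t + 1)"])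
      fix i assume "i \<le> k" then show "x (2 * i) (2 * i + 1) \<in> V"
        using x[of "2 * i" "2 * i + 1"] E_in_V by auto
    next
      fix i j assume ij: "i < j" "j \<le> k"
      let ?p = "x (2 * i) (2 * i + 1)" and ?q = "x (2 * j) (2 * j + 1)"
      have pq: "\<not> E d ?p" "E ?p (s (2 * i))" "\<not> E ?p (s (2 * i + 1))"
        "\<not> E d ?q" "E ?q (s (2 * j))" "\<not> E ?q (s (2 * j + 1))"
        using x[of "2 * i" "2 * i + 1"] x[of "2 * j" "2 * j + 1"] ij by auto
      have l: "E ?p (s (2 * j)) \<longleftrightarrow> \<alpha>" "E ?p (s (2 * j + 1)) \<longleftrightarrow> \<alpha>"
        "E ?q (s (2 * i)) \<longleftrightarrow> \<alpha>" "E ?q (s (2 * i + 1)) \<longleftrightarrow> \<alpha>"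
        using late[of "2 * i" "2 * i + 1"] early[of _ "2 * j" "2 * j + 1"] ij eq by auto
      show "E ?p ?q"
      \<comment> \<open>If the common bit is true, the witnesses cross at the upper ends of their
        pairs, which they miss; if it is false, at the lower ends, to which they are
        attached.\<close>
      proof (cases \<alpha>)
        case True
        then show ?thesis using cross[of ?p ?q "2 * j + 1" "2 * i + 1"] pq l ij by auto
      next
        case False
        then show ?thesis using cross[of ?p ?q "2 * i" "2 * j"] pq l ij by auto
      qed
    qed
  qed
  moreover have "\<not> (\<alpha> \<and> \<not> \<beta>)"
  proof
    assume ab: "\<alpha> \<and> \<not> \<beta>"
    show False
    proof (rule no_clique_sequence[of "\<lambda>t. x t (2 * k + 1 - t)"])
      fix i assume "i \<le> k"
      then have "i < 2 * k + 1 - i" "2 * k + 1 - i < 2 * k + 2" by linarith+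
      then show "x i (2 * k + 1 - i) \<in> V"
        using x[of i "2 * k + 1 - i"] E_in_V by blast
    next
      fix i j assume ij: "i < j" "j \<le> k"
      \<comment> \<open>The inner witness \<open>?q\<close> misses \<open>s i\<close> and is
        attached to \<open>s (2 * k + 1 - i)\<close>; the outer witness \<open>?p\<close> does the
        opposite.\<close>
      let ?p = "x i (2 * k + 1 - i)" and ?q = "x j (2 * k + 1 - j)"
      have "\<not> E d ?p" "E ?p (s i)" "\<not> E ?p (s (2 * k + 1 - i))" "\<not> E d ?q"
        using x[of i "2 * k + 1 - i"] x[of j "2 * k + 1 - j"] ij by auto
      moreover have "\<not> E ?q (s i)" "E ?q (s (2 * k + 1 - i))"
        using early[of i j "2 * k + 1 - j"] late[of j "2 * k + 1 - j" "2 * k + 1 - i"] ab ij by auto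
      ultimately show "E ?p ?q"
        using cross[of ?p ?q i "2 * k + 1 - i"] ij by auto
    qed
  qed
  ultimately show ?thesis by auto
qed

text \<open>The gem: \<open>x\<close> is a witness of prefix type, \<open>y t\<close> are witnesses of suffix type with increasing
  thresholds below that of \<open>x\<close>, and \<open>w\<close> lies above all thresholds.\<close>

lemma prefix_suffix_gem:
  assumes u: "\<And>i. i \<le> 2 * k + 2 \<Longrightarrow> E d (u i) \<and> E x (u i) \<and> \<not> E (u i) w"
    and w: "E d w" "\<not> E d x" "\<not> E x w"
    and y: "\<And>t. t \<le> k \<Longrightarrow> \<not> E d (y t) \<and> E (y t) w"
    and high: "\<And>t i. t \<le> k \<Longrightarrow> 2 * t + 2 \<le> i \<Longrightarrow> i \<le> 2 * k + 2 \<Longrightarrow> E (y t) (u i)"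
    and low: "\<And>t i. t \<le> k \<Longrightarrow> i \<le> 2 * t + 1 \<Longrightarrow> \<not> E (y t) (u i)"
    and indep: "\<And>i j. i < j \<Longrightarrow> j \<le> 2 * k + 2 \<Longrightarrow> \<not> E (u i) (u j)"
  shows False
proof -
  \<comment> \<open>\<open>x\<close> and \<open>y t\<close> cross at \<open>u 0\<close> and
    \<open>w\<close>.\<close>
  have xy: "E x (y t)" if "t \<le> k" for t
    using crossing_imp_adjacent[of d "u 0" w x "y t"] u[of 0] w y[OF that] low[OF that, of 0] by auto
  have "\<exists>i j. i < j \<and> j \<le> k \<and> \<not> E (y i) (y j)"
    using no_clique_sequence[of y] y E_in_V by blast
  then obtain i j where ij: "i < j" "j \<le> k" "\<not> E (y i) (y j)" by blast
  \<comment> \<open>By the thresholds, \<open>y i\<close> is attached to both vertices and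
    \<open>y j\<close> only to \<open>?s'\<close>. The gem is the path \<open>?s\<close>,
    \<open>y i\<close>, \<open>?s'\<close>, \<open>y j\<close> with hub \<open>x\<close>.\<close>
  let ?s = "u (2 * i + 2)" and ?s' = "u (2 * j + 2)"
  have "E x ?s" "E x ?s'" "E x (y i)" "E x (y j)" using u[of "2 * i + 2"] u[of "2 * j + 2"] xy ij by auto
  moreover have "E ?s (y i)" "E (y i) ?s'" "E ?s' (y j)"
    using high[of i] high[of j] ij E_sym by auto
  moreover have "\<not> E ?s ?s'" "\<not> E ?s (y j)"
    using indep[of "2 * i + 2" "2 * j + 2"] low[of j "2 * i + 2"] ij E_sym by auto
  ultimately show False using no_gem[of x ?s "y i" ?s' "y j"] ij by blast
qed

text \<open>The witnesses \<open>x\<close> turn out to be of prefix type on the vertices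
  \<open>s\<close>, the witnesses \<open>y\<close> of suffix type on the vertices \<open>t\<close>.
  A single \<open>x\<close> is compared with many \<open>y\<close>; as it is mixed on at most one
  component, passing from \<open>s\<close> to \<open>t\<close> costs at most one index.\<close>

lemma no_homogeneous_components:
  assumes Q: "\<And>i. i < 2 * k + 8 \<Longrightarrow> conn E (Q i) \<and> (\<forall>q \<in> Q i. E d q) \<and> s i \<in> Q i \<and> t i \<in> Q i"
    and anti: "\<And>i j q r. \<lbrakk>i < 2 * k + 8; j < 2 * k + 8; i \<noteq> j; q \<in> Q i; r \<in> Q j\<rbrakk> \<Longrightarrow> \<not> E q r"
    and x: "\<And>i j. i < j \<Longrightarrow> j < 2 * k + 8 \<Longrightarrow> \<not> E d (x i j) \<and> E (x i j) (s i) \<and> \<not> E (x i j) (s j)"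
    and y: "\<And>i j. i < j \<Longrightarrow> j < 2 * k + 8 \<Longrightarrow> \<not> E d (y i j) \<and> E (y i j) (t j) \<and> \<not> E (y i j) (t i)"
    and late_x: "\<And>i j l. i < j \<Longrightarrow> j < l \<Longrightarrow> l < 2 * k + 8 \<Longrightarrow> E (x i j) (s l) \<longleftrightarrow> \<alpha>"
    and early_x: "\<And>i j l. i < j \<Longrightarrow> j < l \<Longrightarrow> l < 2 * k + 8 \<Longrightarrow> E (x j l) (s i) \<longleftrightarrow> \<beta>"
    and late_y: "\<And>i j l. i < j \<Longrightarrow> j < l \<Longrightarrow> l < 2 * k + 8 \<Longrightarrow> E (y i j) (t l) \<longleftrightarrow> \<gamma>"
    and early_y: "\<And>i j l. i < j \<Longrightarrow> j < l \<Longrightarrow> l < 2 * k + 8 \<Longrightarrow> E (y j l) (t i) \<longleftrightarrow> \<delta>"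
  shows False
proof -
  have ab: "\<not> \<alpha> \<and> \<beta>"
  proof (rule homogeneous_witnesses_prefix[of d s x])
    show "E d (s i)" if "i < 2 * k + 2" for i using Q[of i] that by simp
    show "\<not> E (s i) (s j)" if "i < j" "j < 2 * k + 2" for i j
      using anti[of i j "s i" "s j"] Q[of i] Q[of j] that by simp
  qed (use x late_x early_x in simp_all)
  \<comment> \<open>Reversing the indices turns suffix type into prefix type and exchanges the roles
    of \<open>\<gamma>\<close> and \<open>\<delta>\<close>.\<close>
  define R where "R i = 2 * k + 1 - i" for i
  have R: "R j < R i" "R i < 2 * k + 8" "R j < 2 * k + 8" if "i < j" "j < 2 * k + 2" for i j
    using that by (auto simp: R_def)
  have cd: "\<not> \<delta> \<and> \<gamma>"
  proof (rule homogeneous_witnesses_prefix[of d "\<lambda>i. t (R i)" "\<lambda>i j. y (R j) (R i)"])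
    show "E d (t (R i))" if "i < 2 * k + 2" for i using Q[of "R i"] that by (simp add: R_def)
    show "\<not> E (t (R i)) (t (R j))" if "i < j" "j < 2 * k + 2" for i j
      using anti[of "R i" "R j" "t (R i)" "t (R j)"] Q[of "R i"] Q[of "R j"] R[OF that] by simp
  next
    fix i j assume "i < j" "j < 2 * k + 2"
    then show "\<not> E d (y (R j) (R i)) \<and> E (y (R j) (R i)) (t (R i)) \<and> \<not> E (y (R j) (R i)) (t (R j))"
      using y[of "R j" "R i"] R by simp
  next
    fix i j l assume *: "i < j" "j < l" "l < 2 * k + 2"
    then have "j < 2 * k + 2" by simp
    note r = R[OF *(1) this] R[OF *(2,3)]
    show "E (y (R j) (R i)) (t (R l)) \<longleftrightarrow> \<delta>" using early_y[of "R l" "R j" "R i"] r by simp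
    show "E (y (R l) (R j)) (t (R i)) \<longleftrightarrow> \<gamma>" using late_y[of "R l" "R j" "R i"] r by simp
  qed
  \<comment> \<open>The \<open>2 * k + 3\<close> indices \<open>g 0\<close> to
    \<open>g (2 * k + 2)\<close> below then lie under \<open>?i\<close>, and two indices above
    \<open>?i + 1\<close> remain as candidates for \<open>h\<close>.\<close>
  let ?i = "2 * k + 4"
  let ?x = "x ?i (?i + 1)"
  have x_low: "E ?x (s l)" if "l < ?i" for l using early_x[of l ?i "?i + 1"] ab that by simp
  have x_high: "\<not> E ?x (s l)" if "?i < l" "l < 2 * k + 8" for l
    using late_x[of ?i "?i + 1" l] x[of ?i "?i + 1"] ab that by (cases "l = ?i + 1") auto
  define mixed where "mixed l \<longleftrightarrow> (\<exists>q \<in> Q l. E ?x q) \<and> (\<exists>q \<in> Q l. \<not> E ?x q)" for l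
  have one: "l = m" if "mixed l" "mixed m" "l < 2 * k + 8" "m < 2 * k + 8" for l m
    using mixed_on_at_most_one[of "Q l" "Q m"] that Q anti unfolding mixed_def by metis
  \<comment> \<open>If no component is mixed, any \<open>m\<close> will do.\<close>
  obtain m where m: "\<And>l. l < 2 * k + 8 \<Longrightarrow> l \<noteq> m \<Longrightarrow> \<not> mixed l"
    using one by metis
  have x_t: "E ?x (t l) \<longleftrightarrow> E ?x (s l)" if "l < 2 * k + 8" "l \<noteq> m" for l
    using m[OF that] Q[OF that(1)] unfolding mixed_def by blast
  \<comment> \<open>The increasing enumeration of the indices other than \<open>m\<close>.\<close>
  define g where "g l = (if l < m then l else l + 1)" for l
  have g: "g i < g j" "g i \<noteq> g j" if "i < j" for i j using that by (auto simp: g_def)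
  have g': "g l \<noteq> m" "g l \<le> l + 1" "l \<le> g l" for l by (auto simp: g_def)
  obtain h where h: "h \<noteq> m" "?i + 1 < h" "h < 2 * k + 8"
  proof (cases "m = ?i + 2")
    case True then show ?thesis using that[of "?i + 3"] by simp
  next
    case False then show ?thesis using that[of "?i + 2"] by simp
  qed
  show False
  \<comment> \<open>The witness of the positions \<open>2 * r + 1\<close> and
    \<open>2 * r + 2\<close> of \<open>g\<close> changes from non-adjacent to adjacent exactly
    between them, which is the threshold required.\<close>
  proof (rule prefix_suffix_gem[of d "\<lambda>l. t (g l)" ?x "t h" "\<lambda>r. y (g (2 * r + 1)) (g (2 * r + 2))"])
    fix l assume l: "l \<le> 2 * k + 2"
    then have "g l < ?i" using g'(2)[of l] by simp
    then show "E d (t (g l)) \<and> E ?x (t (g l)) \<and> \<not> E (t (g l)) (t h)"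
      using Q[of "g l"] Q[of h] anti[of "g l" h "t (g l)" "t h"] x_t[of "g l"] x_low[of "g l"] g'(1) h by auto
  next
    show "E d (t h)" "\<not> E ?x (t h)" using Q[of h] h x_t[of h] x_high[of h] by auto
    show "\<not> E d ?x" using x by simp
  next
    fix r assume "r \<le> k"
    moreover have "g (2 * r + 2) \<le> 2 * r + 3" using g'(2)[of "2 * r + 2"] by simp
    ultimately show "\<not> E d (y (g (2 * r + 1)) (g (2 * r + 2))) \<and> E (y (g (2 * r + 1)) (g (2 * r + 2))) (t h)"
      using y[of "g (2 * r + 1)" "g (2 * r + 2)"] late_y[of "g (2 * r + 1)" "g (2 * r + 2)" h]
        g(1)[of "2 * r + 1" "2 * r + 2"] cd h by auto
  next
    fix r i assume r: "r \<le> k" "2 * r + 2 \<le> i" "i \<le> 2 * k + 2"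
    then have "g i < 2 * k + 8" using g'(2)[of i] by simp
    moreover have "i = 2 * r + 2 \<or> g (2 * r + 2) < g i" using g(1)[of "2 * r + 2" i] r by (metis le_neq_implies_less)
    ultimately show "E (y (g (2 * r + 1)) (g (2 * r + 2))) (t (g i))"
      using y[of "g (2 * r + 1)" "g (2 * r + 2)"] late_y[of "g (2 * r + 1)" "g (2 * r + 2)" "g i"]
        g(1)[of "2 * r + 1" "2 * r + 2"] cd by auto
  next
    fix r i assume r: "r \<le> k" "i \<le> 2 * r + 1"
    then have "g (2 * r + 2) < 2 * k + 8" using g'(2)[of "2 * r + 2"] by simp
    moreover have "i = 2 * r + 1 \<or> g i < g (2 * r + 1)" using g(1)[of i "2 * r + 1"] r by (metis le_neq_implies_less)
    ultimately show "\<not> E (y (g (2 * r + 1)) (g (2 * r + 2))) (t (g i))"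
      using y[of "g (2 * r + 1)" "g (2 * r + 2)"] early_y[of "g i" "g (2 * r + 1)" "g (2 * r + 2)"]
        g(1)[of "2 * r + 1" "2 * r + 2"] cd by auto
  next
    fix i j :: nat assume "i < j" "j \<le> 2 * k + 2"
    then show "\<not> E (t (g i)) (t (g j))"
      using anti[of "g i" "g j"] Q[of "g i"] Q[of "g j"] g[of i j] g'(2)[of j] by auto
  qed
qed

end

section \<open>Bounding modules of a neighbourhood\<close>

text \<open>Ramsey's theorem for triples makes the four adjacency bits constant. The graph is
  quantified inside, with \<open>critical_graph\<close> as an explicit predicate, so that one
  \<open>n\<close> serves all graphs.\<close>

lemma bounded_witnessed_components:
  "\<exists>n::nat. \<forall>V (E :: 'a \<Rightarrow> 'a \<Rightarrow> bool) d Q s t x y. critical_graph k V E \<longrightarrow>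
    (\<forall>i<n. conn E (Q i) \<and> (\<forall>q \<in> Q i. E d q) \<and> s i \<in> Q i \<and> t i \<in> Q i) \<longrightarrow>
    (\<forall>i<n. \<forall>j<n. i \<noteq> j \<longrightarrow> (\<forall>q \<in> Q i. \<forall>r \<in> Q j. \<not> E q r)) \<longrightarrow>
    (\<forall>i j. i < j \<longrightarrow> j < n \<longrightarrow> \<not> E d (x i j) \<and> E (x i j) (s i) \<and> \<not> E (x i j) (s j)) \<longrightarrow>
    (\<forall>i j. i < j \<longrightarrow> j < n \<longrightarrow> \<not> E d (y i j) \<and> E (y i j) (t j) \<and> \<not> E (y i j) (t i)) \<longrightarrow> False"
proof -
  let ?N = "2 * k + 8"
  obtain n where n: "\<forall>F :: nat \<Rightarrow> nat \<Rightarrow> nat \<Rightarrow> (bool \<times> bool) \<times> bool \<times> bool.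
    (\<forall>i j l. i < j \<longrightarrow> j < l \<longrightarrow> l < n \<longrightarrow> F i j l \<in> UNIV) \<longrightarrow>
    (\<exists>e c. (\<forall>i j. i < j \<longrightarrow> j < ?N \<longrightarrow> e i < e j) \<and> (\<forall>i<?N. e i < n) \<and>
      (\<forall>i j l. i < j \<longrightarrow> j < l \<longrightarrow> l < ?N \<longrightarrow> F (e i) (e j) (e l) = c))"
    using ramsey_triples[of "UNIV :: ((bool \<times> bool) \<times> bool \<times> bool) set" ?N] by auto
  show ?thesis
  proof (intro exI[of _ n] allI impI)
    fix V and E :: "'a \<Rightarrow> 'a \<Rightarrow> bool" and d Q s t x y
    assume "critical_graph k V E"
      and Q: "\<forall>i<n. conn E (Q i) \<and> (\<forall>q \<in> Q i. E d q) \<and> s i \<in> Q i \<and> t i \<in> Q i"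
      and anti: "\<forall>i<n. \<forall>j<n. i \<noteq> j \<longrightarrow> (\<forall>q \<in> Q i. \<forall>r \<in> Q j. \<not> E q r)"
      and x: "\<forall>i j. i < j \<longrightarrow> j < n \<longrightarrow> \<not> E d (x i j) \<and> E (x i j) (s i) \<and> \<not> E (x i j) (s j)"
      and y: "\<forall>i j. i < j \<longrightarrow> j < n \<longrightarrow> \<not> E d (y i j) \<and> E (y i j) (t j) \<and> \<not> E (y i j) (t i)"
    interpret critical_graph k V E by fact
    \<comment> \<open>The witness of a pair is tested against a later and against an earlier
      component, for both families of witnesses.\<close>
    define F where "F i j l = ((E (x i j) (s l), E (x j l) (s i)), E (y i j) (t l), E (y j l) (t i))" for i j l
    obtain e c where "(\<forall>i j. i < j \<longrightarrow> j < ?N \<longrightarrow> e i < e j) \<and> (\<forall>i<?N. e i < n) \<and>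
      (\<forall>i j l. i < j \<longrightarrow> j < l \<longrightarrow> l < ?N \<longrightarrow> F (e i) (e j) (e l) = c)"
      using n[rule_format, of F, OF UNIV_I] by (elim exE)
    then have e: "\<And>i j. i < j \<Longrightarrow> j < ?N \<Longrightarrow> e i < e j" "\<And>i. i < ?N \<Longrightarrow> e i < n"
      "\<And>i j l. i < j \<Longrightarrow> j < l \<Longrightarrow> l < ?N \<Longrightarrow> F (e i) (e j) (e l) = c"
      by simp_all
    obtain \<alpha> \<beta> \<gamma> \<delta> where c: "c = ((\<alpha>, \<beta>), \<gamma>, \<delta>)" by (metis prod.exhaust)
    have inj: "e i \<noteq> e j" if "i < ?N" "j < ?N" "i \<noteq> j" for i j
      using e(1)[of i j] e(1)[of j i] that by (metis nat_neq_iff)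
    have bits: "E (x (e i) (e j)) (s (e l)) \<longleftrightarrow> \<alpha>" "E (x (e j) (e l)) (s (e i)) \<longleftrightarrow> \<beta>"
      "E (y (e i) (e j)) (t (e l)) \<longleftrightarrow> \<gamma>" "E (y (e j) (e l)) (t (e i)) \<longleftrightarrow> \<delta>"
      if "i < j" "j < l" "l < ?N" for i j l
      using e(3)[OF that] unfolding F_def c by simp_all
    show False
    proof (rule no_homogeneous_components[of "Q \<circ> e" d "s \<circ> e" "t \<circ> e" "\<lambda>i j. x (e i) (e j)" "\<lambda>i j. y (e i) (e j)" \<alpha> \<beta> \<gamma> \<delta>])
      fix i j q r
      assume "i < ?N" "j < ?N" "i \<noteq> j" "q \<in> (Q \<circ> e) i" "r \<in> (Q \<circ> e) j"
      then show "\<not> E q r" using anti[rule_format, of "e i" "e j" q r] e(2) inj by simp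
    next
      fix i assume "i < ?N"
      then show "conn E ((Q \<circ> e) i) \<and> (\<forall>q \<in> (Q \<circ> e) i. E d q) \<and>
        (s \<circ> e) i \<in> (Q \<circ> e) i \<and> (t \<circ> e) i \<in> (Q \<circ> e) i"
        using Q e(2) unfolding comp_def by blast
    qed (use x y e(1,2) bits in simp_all)
  qed
qed

text \<open>The label \<open>a i j\<close> at which a witness tells two components apart varies with
  the pair. Ramsey's theorem for pairs makes the labels of both orientations constants
  \<open>b\<close> and \<open>b'\<close>; these select the vertices \<open>s\<close> and
  \<open>t\<close>, and the two orientations of \<open>z\<close> become \<open>x\<close> and
  \<open>y\<close>.\<close>

lemma bounded_labelled_components:
  "\<exists>n::nat. \<forall>V (E :: 'a \<Rightarrow> 'a \<Rightarrow> bool) d (\<phi> :: nat \<Rightarrow> nat \<Rightarrow> 'a) m a z. critical_graph k V E \<longrightarrow> m \<le> c \<longrightarrow>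
    (\<forall>i<n. conn E (\<phi> i ` {..<m}) \<and> (\<forall>q<m. E d (\<phi> i q))) \<longrightarrow>
    (\<forall>i<n. \<forall>j<n. i \<noteq> j \<longrightarrow> (\<forall>q<m. \<forall>r<m. \<not> E (\<phi> i q) (\<phi> j r))) \<longrightarrow>
    (\<forall>i<n. \<forall>j<n. i \<noteq> j \<longrightarrow> a i j < m \<and> \<not> E d (z i j) \<and>
      E (z i j) (\<phi> i (a i j)) \<and> \<not> E (z i j) (\<phi> j (a i j))) \<longrightarrow> False"
proof -
  obtain N :: nat where N: "\<forall>V (E :: 'a \<Rightarrow> 'a \<Rightarrow> bool) d Q s t x y. critical_graph k V E \<longrightarrow>
    (\<forall>i<N. conn E (Q i) \<and> (\<forall>q \<in> Q i. E d q) \<and> s i \<in> Q i \<and> t i \<in> Q i) \<longrightarrow>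
    (\<forall>i<N. \<forall>j<N. i \<noteq> j \<longrightarrow> (\<forall>q \<in> Q i. \<forall>r \<in> Q j. \<not> E q r)) \<longrightarrow>
    (\<forall>i j. i < j \<longrightarrow> j < N \<longrightarrow> \<not> E d (x i j) \<and> E (x i j) (s i) \<and> \<not> E (x i j) (s j)) \<longrightarrow>
    (\<forall>i j. i < j \<longrightarrow> j < N \<longrightarrow> \<not> E d (y i j) \<and> E (y i j) (t j) \<and> \<not> E (y i j) (t i)) \<longrightarrow> False"
    using bounded_witnessed_components[of k] ..
  have "finite ({..<c} \<times> {..<c})" by simp
  \<comment> \<open>Two spare indices ensure that the constant colour is attained and hence consists of labels below \<open>m\<close>.\<close>
  from ramsey_pairs[OF this, of "Suc (Suc N)"] obtain n where n: "\<forall>F :: nat \<Rightarrow> nat \<Rightarrow> nat \<times> nat.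
    (\<forall>i j. i < j \<longrightarrow> j < n \<longrightarrow> F i j \<in> {..<c} \<times> {..<c}) \<longrightarrow>
    (\<exists>e c. (\<forall>i j. i < j \<longrightarrow> j < Suc (Suc N) \<longrightarrow> e i < e j \<and> F (e i) (e j) = c) \<and> (\<forall>i<Suc (Suc N). e i < n))" ..
  show ?thesis
  proof (intro exI[of _ n] allI impI)
    fix V and E :: "'a \<Rightarrow> 'a \<Rightarrow> bool" and d and \<phi> :: "nat \<Rightarrow> nat \<Rightarrow> 'a" and m a z
    assume crit: "critical_graph k V E" and mc: "m \<le> c"
      and Q: "\<forall>i<n. conn E (\<phi> i ` {..<m}) \<and> (\<forall>q<m. E d (\<phi> i q))"
      and anti: "\<forall>i<n. \<forall>j<n. i \<noteq> j \<longrightarrow> (\<forall>q<m. \<forall>r<m. \<not> E (\<phi> i q) (\<phi> j r))"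
      and z: "\<forall>i<n. \<forall>j<n. i \<noteq> j \<longrightarrow> a i j < m \<and> \<not> E d (z i j) \<and>
        E (z i j) (\<phi> i (a i j)) \<and> \<not> E (z i j) (\<phi> j (a i j))"
    have am: "a i j < m" if "i < n" "j < n" "i \<noteq> j" for i j using z that by blast
    then have "a i j < c" if "i < n" "j < n" "i \<noteq> j" for i j
      using mc that less_le_trans by blast
    then have "(a i j, a j i) \<in> {..<c} \<times> {..<c}" if "i < j" "j < n" for i j
      using that by simp
    from n[rule_format, of "\<lambda>i j. (a i j, a j i)", OF this]
    obtain e p where e: "\<forall>i j. i < j \<longrightarrow> j < Suc (Suc N) \<longrightarrow> e i < e j \<and> (a (e i) (e j), a (e j) (e i)) = p"
      "\<forall>i<Suc (Suc N). e i < n" by auto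
    obtain b b' where p: "p = (b, b')" by fastforce
    have ab: "e i < e j" "a (e i) (e j) = b" "a (e j) (e i) = b'" if "i < j" "j < Suc (Suc N)" for i j
      using e(1) that p by auto
    have en: "e i < n" if "i < Suc (Suc N)" for i using e(2) that by blast
    have inj: "e i \<noteq> e j" if "i < Suc (Suc N)" "j < Suc (Suc N)" "i \<noteq> j" for i j
      using ab(1)[of i j] ab(1)[of j i] that by (metis nat_neq_iff)
    have bm: "b < m" "b' < m"
      using am[OF en en inj, of 0 1] am[OF en en inj, of 1 0] ab(2,3)[of 0 1] by simp_all
    show False
    proof (rule N[rule_format, of V E "\<lambda>i. \<phi> (e i) ` {..<m}" d "\<lambda>i. \<phi> (e i) b" "\<lambda>i. \<phi> (e i) b'"
          "\<lambda>i j. z (e i) (e j)" "\<lambda>i j. z (e j) (e i)"])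
      show "critical_graph k V E" by fact
    next
      fix i assume "i < N"
      then show "conn E (\<phi> (e i) ` {..<m}) \<and> (\<forall>q \<in> \<phi> (e i) ` {..<m}. E d q) \<and>
        \<phi> (e i) b \<in> \<phi> (e i) ` {..<m} \<and> \<phi> (e i) b' \<in> \<phi> (e i) ` {..<m}"
        using Q en[of i] bm by auto
    next
      fix i j q r assume "i < N" "j < N" "i \<noteq> j" "q \<in> \<phi> (e i) ` {..<m}" "r \<in> \<phi> (e j) ` {..<m}"
      then show "\<not> E q r" using anti en[of i] en[of j] inj[of i j] by auto
    next
      fix i j assume "i < j" "j < N"
      then show "\<not> E d (z (e i) (e j)) \<and> E (z (e i) (e j)) (\<phi> (e i) b) \<and> \<not> E (z (e i) (e j)) (\<phi> (e j) b)"
        using z[rule_format, of "e i" "e j"] en[of i] en[of j] inj[of i j] ab[of i j] by simp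
    next
      fix i j assume "i < j" "j < N"
      then show "\<not> E d (z (e j) (e i)) \<and> E (z (e j) (e i)) (\<phi> (e j) b') \<and> \<not> E (z (e j) (e i)) (\<phi> (e i) b')"
        using z[rule_format, of "e j" "e i"] en[of i] en[of j] inj[of i j] ab[of i j] by simp
    qed
  qed
qed

text \<open>Criticality, applied to the isomorphism from \<open>Q\<close> to \<open>R\<close>, gives
  a vertex \<open>z\<close> outside \<open>Q\<close> adjacent to some vertex of \<open>Q\<close> but
  not to its image. If \<open>z\<close> were adjacent to \<open>d\<close>, \<open>mod\<close> would
  make it adjacent to all of \<open>R\<close>.\<close>

lemma (in critical_graph) isomorphic_components_witness:
  assumes \<phi>: "bij_betw \<phi> {..<m} Q" and \<psi>: "bij_betw \<psi> {..<m} R"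
    and iso: "\<And>u v. u < m \<Longrightarrow> v < m \<Longrightarrow> E (\<phi> u) (\<phi> v) \<longleftrightarrow> E (\<psi> u) (\<psi> v)"
    and Q: "Q \<noteq> {}" "Q \<inter> R = {}" and d: "\<And>q. q \<in> Q \<union> R \<Longrightarrow> E d q"
    and mod: "\<And>z q r. z \<notin> Q \<Longrightarrow> E d z \<Longrightarrow> q \<in> Q \<Longrightarrow> E z q \<Longrightarrow> r \<in> R \<Longrightarrow> E z r"
  shows "\<exists>a<m. \<exists>z. \<not> E d z \<and> E z (\<phi> a) \<and> \<not> E z (\<psi> a)"
proof -
  define f where "f = (\<lambda>q. \<psi> (inv_into {..<m} \<phi> q))"
  have inv: "inv_into {..<m} \<phi> q < m" "\<phi> (inv_into {..<m} \<phi> q) = q" if "q \<in> Q" for q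
    using that \<phi> bij_betw_inv_into_right[OF \<phi>] bij_betwE[OF bij_betw_inv_into[OF \<phi>]] by auto
  have fR: "f q \<in> R" if "q \<in> Q" for q
    using inv(1)[OF that] \<psi> by (auto simp: f_def bij_betw_def)
  have "\<exists>q\<in>Q. \<exists>z. z \<notin> Q \<and> E q z \<and> \<not> E (f q) z"
  proof (rule hom_not_dominating)
    show "Q \<subseteq> V" "Q \<noteq> {}" "f ` Q \<subseteq> V - Q" using Q d fR E_in_V' by blast+
    show "E (f q) (f r)" if "q \<in> Q" "r \<in> Q" "E q r" for q r
      using iso[OF inv(1) inv(1), of q r] that inv(2) by (simp add: f_def)
  qed
  then obtain q z where z: "q \<in> Q" "z \<notin> Q" "E q z" "\<not> E (f q) z" by blast
  then have "\<not> E d z" using mod fR E_sym by blast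
  then show ?thesis using z inv[OF z(1)] E_sym unfolding f_def by metis
qed

text \<open>By pigeonhole, many components share their order and labelled adjacency relation;
  \<open>isomorphic_components_witness\<close> then serves every ordered pair of them.\<close>

lemma bounded_components:
  "\<exists>n::nat. \<forall>V (E :: 'a \<Rightarrow> 'a \<Rightarrow> bool) d Q. critical_graph k V E \<longrightarrow>
    (\<forall>i<n. conn E (Q i) \<and> (\<forall>q \<in> Q i. E d q) \<and> card (Q i) \<le> c) \<longrightarrow>
    (\<forall>i<n. \<forall>j<n. i \<noteq> j \<longrightarrow> Q i \<inter> Q j = {} \<and> (\<forall>q \<in> Q i. \<forall>r \<in> Q j. \<not> E q r)) \<longrightarrow>
    (\<forall>i<n. \<forall>j<n. i \<noteq> j \<longrightarrow> (\<forall>z q r. z \<notin> Q i \<longrightarrow> E d z \<longrightarrow> q \<in> Q i \<longrightarrow> E z q \<longrightarrow> r \<in> Q j \<longrightarrow> E z r)) \<longrightarrow> False"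
proof -
  obtain N :: nat where N: "\<forall>V (E :: 'a \<Rightarrow> 'a \<Rightarrow> bool) d (\<phi> :: nat \<Rightarrow> nat \<Rightarrow> 'a) m a z. critical_graph k V E \<longrightarrow> m \<le> c \<longrightarrow>
    (\<forall>i<N. conn E (\<phi> i ` {..<m}) \<and> (\<forall>q<m. E d (\<phi> i q))) \<longrightarrow>
    (\<forall>i<N. \<forall>j<N. i \<noteq> j \<longrightarrow> (\<forall>q<m. \<forall>r<m. \<not> E (\<phi> i q) (\<phi> j r))) \<longrightarrow>
    (\<forall>i<N. \<forall>j<N. i \<noteq> j \<longrightarrow> a i j < m \<and> \<not> E d (z i j) \<and>
      E (z i j) (\<phi> i (a i j)) \<and> \<not> E (z i j) (\<phi> j (a i j))) \<longrightarrow> False"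
    using bounded_labelled_components[of k c] ..
  let ?T = "{..c} \<times> Pow ({..<c} \<times> {..<c})"
  have "finite ?T" by simp
  \<comment> \<open>The spare index 0 yields \<open>m \<le> c\<close> even when
    \<open>N = 0\<close>.\<close>
  from ramsey_points[OF this, of "Suc N"] obtain n where n: "\<forall>F :: nat \<Rightarrow> nat \<times> (nat \<times> nat) set.
    (\<forall>i<n. F i \<in> ?T) \<longrightarrow>
    (\<exists>e c. (\<forall>i j. i < j \<longrightarrow> j < Suc N \<longrightarrow> e i < e j) \<and> (\<forall>i<Suc N. e i < n \<and> F (e i) = c))" ..
  show ?thesis
  proof (intro exI[of _ n] allI impI)
    fix V and E :: "'a \<Rightarrow> 'a \<Rightarrow> bool" and d Q
    assume crit: "critical_graph k V E"
      and Q: "\<forall>i<n. conn E (Q i) \<and> (\<forall>q \<in> Q i. E d q) \<and> card (Q i) \<le> c"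
      and anti: "\<forall>i<n. \<forall>j<n. i \<noteq> j \<longrightarrow> Q i \<inter> Q j = {} \<and> (\<forall>q \<in> Q i. \<forall>r \<in> Q j. \<not> E q r)"
      and mod: "\<forall>i<n. \<forall>j<n. i \<noteq> j \<longrightarrow>
        (\<forall>z q r. z \<notin> Q i \<longrightarrow> E d z \<longrightarrow> q \<in> Q i \<longrightarrow> E z q \<longrightarrow> r \<in> Q j \<longrightarrow> E z r)"
    interpret critical_graph k V E by fact
    have "finite (Q i)" if "i < n" for i
      using that Q E_in_V' finite_V by (meson finite_subset subsetI)
    then have "\<forall>i. \<exists>f. i < n \<longrightarrow> bij_betw f {..<card (Q i)} (Q i)"
      using ex_bij_betw_nat_finite by (metis atLeast0LessThan)
    then obtain \<psi> where \<psi>: "\<And>i. i < n \<Longrightarrow> bij_betw (\<psi> i) {..<card (Q i)} (Q i)" by metis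
    define F where "F i = (card (Q i),
      {(u, v). u < card (Q i) \<and> v < card (Q i) \<and> E (\<psi> i u) (\<psi> i v)})" for i
    have "\<forall>i<n. F i \<in> ?T" using Q by (auto simp: F_def)
    from n[rule_format, of F, OF this[rule_format]]
    obtain e p where e: "\<forall>i j. i < j \<longrightarrow> j < Suc N \<longrightarrow> e i < e j" "\<forall>i<Suc N. e i < n \<and> F (e i) = p" by auto
    define m where "m = fst p"
    have en: "e i < n" "card (Q (e i)) = m" "F (e i) = p" if "i < Suc N" for i
      using e(2) that by (auto simp: m_def F_def)
    have inj: "e i \<noteq> e j" if "i < Suc N" "j < Suc N" "i \<noteq> j" for i j
      using e(1) that by (metis nat_neq_iff)
    define \<phi> where "\<phi> i = \<psi> (e i)" for i
    have \<phi>: "bij_betw (\<phi> i) {..<m} (Q (e i))" if "i < Suc N" for i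
      using \<psi>[of "e i"] en[OF that] by (simp add: \<phi>_def)
    have img: "\<phi> i ` {..<m} = Q (e i)" if "i < Suc N" for i
      using \<phi>[OF that] by (simp add: bij_betw_def)
    have iso: "E (\<phi> i u) (\<phi> i v) \<longleftrightarrow> E (\<phi> j u) (\<phi> j v)"
      if "i < Suc N" "j < Suc N" "u < m" "v < m" for i j u v
    proof -
      have "E (\<phi> l u) (\<phi> l v) \<longleftrightarrow> (u, v) \<in> snd p" if "l < Suc N" for l
      proof -
        have "snd p = snd (F (e l))" using en(3)[OF that] by simp
        then show ?thesis using en(2)[OF that] \<open>u < m\<close> \<open>v < m\<close> by (simp add: F_def \<phi>_def)
      qed
      then show ?thesis using that by blast
    qed
    have "\<forall>i j. \<exists>a z. i < N \<longrightarrow> j < N \<longrightarrow> i \<noteq> j \<longrightarrow>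
      a < m \<and> \<not> E d z \<and> E z (\<phi> i a) \<and> \<not> E z (\<phi> j a)"
    proof (intro allI)
      fix i j
      show "\<exists>a z. i < N \<longrightarrow> j < N \<longrightarrow> i \<noteq> j \<longrightarrow> a < m \<and> \<not> E d z \<and> E z (\<phi> i a) \<and> \<not> E z (\<phi> j a)"
      proof (cases "i < N \<and> j < N \<and> i \<noteq> j")
        case True
        then have l: "i < Suc N" "j < Suc N" "i \<noteq> j" by auto
        have "\<exists>a<m. \<exists>z. \<not> E d z \<and> E z (\<phi> i a) \<and> \<not> E z (\<phi> j a)"
        proof (rule isomorphic_components_witness[OF \<phi> \<phi>])
          show "E (\<phi> i u) (\<phi> i v) \<longleftrightarrow> E (\<phi> j u) (\<phi> j v)" if "u < m" "v < m" for u v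
            using iso l that by blast
          show "Q (e i) \<noteq> {}" using Q en(1)[OF l(1)] by (auto simp: conn_def)
          show "Q (e i) \<inter> Q (e j) = {}" using anti en(1) l inj by blast
          show "E d q" if "q \<in> Q (e i) \<union> Q (e j)" for q using Q en(1) l that by blast
          show "E z r" if "z \<notin> Q (e i)" "E d z" "q \<in> Q (e i)" "E z q" "r \<in> Q (e j)" for z q r
            using mod en(1) inj l that by blast
        qed (use l in auto)
        then show ?thesis by blast
      qed auto
    qed
    then obtain a z where z: "\<And>i j. i < N \<Longrightarrow> j < N \<Longrightarrow> i \<noteq> j \<Longrightarrow>
      a i j < m \<and> \<not> E d (z i j) \<and> E (z i j) (\<phi> i (a i j)) \<and> \<not> E (z i j) (\<phi> j (a i j))"
      by metis
    show False
    proof (rule N[rule_format, of V E m \<phi> d a z])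
      show "critical_graph k V E" by fact
      show "m \<le> c" using Q en(1,2)[of 0] by auto
      show "conn E (\<phi> i ` {..<m}) \<and> (\<forall>q<m. E d (\<phi> i q))" if "i < N" for i
        using that Q en(1)[of i] img[of i] by auto
      show "\<not> E (\<phi> i q) (\<phi> j r)" if "i < N" "j < N" "i \<noteq> j" "q < m" "r < m" for i j q r
      proof -
        have "\<phi> i q \<in> Q (e i)" "\<phi> j r \<in> Q (e j)"
          using img[of i] img[of j] that by auto
        then show ?thesis using that anti[rule_format, of "e i" "e j"] en(1) inj by simp
      qed
    qed (use z in blast)
  qed
qed

text \<open>Only vertices \<open>z\<close> adjacent to \<open>d\<close> are tested, so
  \<open>W\<close> is a module of the neighbourhood of \<open>d\<close>, not of the whole graph. In
  a join, a vertex of one side extends every clique of the other, so the clique bound drops on both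
  sides.\<close>

lemma bounded_modules:
  "\<exists>b::nat. \<forall>V (E :: 'a \<Rightarrow> 'a \<Rightarrow> bool) d W. critical_graph k V E \<longrightarrow> (\<forall>w\<in>W. E d w) \<longrightarrow>
    (\<forall>z v w. z \<notin> W \<longrightarrow> E d z \<longrightarrow> v \<in> W \<longrightarrow> E z v \<longrightarrow> w \<in> W \<longrightarrow> E z w) \<longrightarrow>
    (\<forall>K. K \<subseteq> W \<longrightarrow> (\<forall>x\<in>K. \<forall>y\<in>K. x \<noteq> y \<longrightarrow> E x y) \<longrightarrow> card K \<le> m) \<longrightarrow> card W \<le> b"
proof (induction m)
  case 0
  show ?case
  proof (intro exI[of _ 0] allI impI)
    fix V and E :: "'a \<Rightarrow> 'a \<Rightarrow> bool" and d W
    assume K: "\<forall>K. K \<subseteq> W \<longrightarrow> (\<forall>x\<in>K. \<forall>y\<in>K. x \<noteq> y \<longrightarrow> E x y) \<longrightarrow> card K \<le> 0"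
    have "w \<notin> W" for w using K[rule_format, of "{w}"] by auto
    then show "card W \<le> 0" by (metis all_not_in_conv card.empty order_refl)
  qed
next
  case (Suc m)
  then obtain b :: nat where b: "\<forall>V (E :: 'a \<Rightarrow> 'a \<Rightarrow> bool) d W. critical_graph k V E \<longrightarrow> (\<forall>w\<in>W. E d w) \<longrightarrow>
    (\<forall>z v w. z \<notin> W \<longrightarrow> E d z \<longrightarrow> v \<in> W \<longrightarrow> E z v \<longrightarrow> w \<in> W \<longrightarrow> E z w) \<longrightarrow>
    (\<forall>K. K \<subseteq> W \<longrightarrow> (\<forall>x\<in>K. \<forall>y\<in>K. x \<noteq> y \<longrightarrow> E x y) \<longrightarrow> card K \<le> m) \<longrightarrow> card W \<le> b" ..
  \<comment> \<open>Covers single vertices as well as joins of two sets of size at most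
    \<open>b\<close>.\<close>
  define c where "c = Suc (b + b)"
  obtain n :: nat where n: "\<forall>V (E :: 'a \<Rightarrow> 'a \<Rightarrow> bool) d Q. critical_graph k V E \<longrightarrow>
    (\<forall>i<n. conn E (Q i) \<and> (\<forall>q \<in> Q i. E d q) \<and> card (Q i) \<le> c) \<longrightarrow>
    (\<forall>i<n. \<forall>j<n. i \<noteq> j \<longrightarrow> Q i \<inter> Q j = {} \<and> (\<forall>q \<in> Q i. \<forall>r \<in> Q j. \<not> E q r)) \<longrightarrow>
    (\<forall>i<n. \<forall>j<n. i \<noteq> j \<longrightarrow> (\<forall>z q r. z \<notin> Q i \<longrightarrow> E d z \<longrightarrow> q \<in> Q i \<longrightarrow> E z q \<longrightarrow> r \<in> Q j \<longrightarrow> E z r)) \<longrightarrow> False"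
    using bounded_components[of k c] ..
  show ?case
  proof (intro exI[of _ "n * c"] allI impI)
    fix V and E :: "'a \<Rightarrow> 'a \<Rightarrow> bool" and d W
    assume crit: "critical_graph k V E" and dW: "\<forall>w\<in>W. E d w"
      and mod: "\<forall>z v w. z \<notin> W \<longrightarrow> E d z \<longrightarrow> v \<in> W \<longrightarrow> E z v \<longrightarrow> w \<in> W \<longrightarrow> E z w"
      and cl: "\<forall>K. K \<subseteq> W \<longrightarrow> (\<forall>x\<in>K. \<forall>y\<in>K. x \<noteq> y \<longrightarrow> E x y) \<longrightarrow> card K \<le> Suc m"
    interpret critical_graph k V E by fact
    have symp: "symp E" using E_sym by (auto intro: sympI)
    have irr: "irreflp E" using E_irrefl by (auto intro: irreflpI)
    have "W \<subseteq> V" using dW E_in_V' by blast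
    then have finW: "finite W" using finite_V finite_subset by blast
    obtain \<C> where "\<Union>\<C> = W \<and> (\<forall>Q\<in>\<C>. conn E Q) \<and>
      (\<forall>Q\<in>\<C>. \<forall>R\<in>\<C>. Q \<noteq> R \<longrightarrow> Q \<inter> R = {} \<and> (\<forall>q\<in>Q. \<forall>r\<in>R. \<not> E q r))"
      using components_exist[OF finW symp] ..
    then have C: "\<Union>\<C> = W" "\<And>Q. Q \<in> \<C> \<Longrightarrow> conn E Q"
      "\<And>Q R. Q \<in> \<C> \<Longrightarrow> R \<in> \<C> \<Longrightarrow> Q \<noteq> R \<Longrightarrow> Q \<inter> R = {} \<and> (\<forall>q\<in>Q. \<forall>r\<in>R. \<not> E q r)"
      by simp_all
    have half: "card A \<le> b" if Q: "Q \<in> \<C>" and AB: "A \<union> B = Q" "A \<inter> B = {}" "B \<noteq> {}"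
      and join: "\<And>x y. x \<in> A \<Longrightarrow> y \<in> B \<Longrightarrow> E x y" for Q A B
    proof (rule b[rule_format, OF crit, of A d])
      have QW: "Q \<subseteq> W" using Q C(1) by blast
      show "E d w" if "w \<in> A" for w using that dW QW AB(1) by blast
      show "E z w" if *: "z \<notin> A" "E d z" "v \<in> A" "E z v" "w \<in> A" for z v w
      proof -
        have vw: "v \<in> Q" "w \<in> Q" using * AB(1) by auto
        \<comment> \<open>The module property of \<open>W\<close> settles the first case and the
          join the second; in the third, \<open>z\<close> has no neighbour in
          \<open>A\<close>.\<close>
        consider "z \<notin> W" | "z \<in> B" | R where "R \<in> \<C>" "z \<in> R" "R \<noteq> Q"
          using C(1) *(1) AB(1) by blast
        then show "E z w"
        proof cases
          case 1 then show ?thesis using mod * vw QW by blast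
        next
          case 2 then show ?thesis using join *(5) E_sym by blast
        next
          case 3 then show ?thesis using C(3)[OF 3(1) Q 3(3)] vw(1) *(4) by blast
        qed
      qed
      show "card K \<le> m" if K: "K \<subseteq> A" "\<And>x y. x \<in> K \<Longrightarrow> y \<in> K \<Longrightarrow> x \<noteq> y \<Longrightarrow> E x y" for K
      proof -
        obtain y where y: "y \<in> B" using AB(3) by blast
        have "insert y K \<subseteq> W" using K(1) y AB(1) QW by blast
        moreover have "\<forall>u\<in>insert y K. \<forall>v\<in>insert y K. u \<noteq> v \<longrightarrow> E u v"
          using K join[OF _ y] E_sym by blast
        ultimately have "card (insert y K) \<le> Suc m" using cl by blast
        moreover have "finite K" using K(1) AB(1) QW finW by (meson finite_subset sup.boundedE subset_trans)
        moreover have "y \<notin> K" using y K(1) AB(2) by blast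
        ultimately show "card K \<le> m" by simp
      qed
    qed
    have small: "card Q \<le> c" if Q: "Q \<in> \<C>" for Q
    proof (cases "card Q \<ge> 2")
      case True
      have QW: "Q \<subseteq> W" using Q C(1) by blast
      have finQ: "finite Q" using QW finW finite_subset by blast
      obtain A B where AB: "A \<union> B = Q" "A \<inter> B = {}" "A \<noteq> {}" "B \<noteq> {}"
        "\<And>x y. x \<in> A \<Longrightarrow> y \<in> B \<Longrightarrow> E x y"
      proof (rule P4_free_conn_join[OF finQ symp irr True C(2)[OF Q]])
        fix p q r s assume "p \<in> Q" "q \<in> Q" "r \<in> Q" "s \<in> Q" "E p q" "E q r" "E r s"
          "\<not> E p r" "\<not> E p s" "\<not> E q s"
        \<comment> \<open>Such a path and the hub \<open>d\<close> form a gem.\<close>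
        then show False using no_gem[of d p q r s] dW QW by blast
      qed (rule that)
      have "card A \<le> b" using half[OF Q AB(1,2,4,5)] .
      moreover have "card B \<le> b"
        using half[OF Q, of B A] AB E_sym by (simp add: Un_commute Int_commute)
      moreover have "card Q \<le> card A + card B" using AB(1) card_Un_le by metis
      ultimately show ?thesis by (simp add: c_def)
    qed (simp add: c_def)
    have finC: "finite \<C>" using C(1) finW finite_UnionD by metis
    have "card \<C> < n"
    proof (rule ccontr)
      assume "\<not> card \<C> < n"
      then have nC: "n \<le> card \<C>" by simp
      obtain Q where "bij_betw Q {..<card \<C>} \<C>"
        using ex_bij_betw_nat_finite[OF finC] by (auto simp: atLeast0LessThan)
      then have Q: "\<And>i. i < n \<Longrightarrow> Q i \<in> \<C>" "\<And>i j. i < n \<Longrightarrow> j < n \<Longrightarrow> i \<noteq> j \<Longrightarrow> Q i \<noteq> Q j"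
        using nC by (auto simp: bij_betw_def inj_on_def)
      show False
      proof (rule n[rule_format, of V E Q d])
        show "critical_graph k V E" by fact
        show "conn E (Q i) \<and> (\<forall>q \<in> Q i. E d q) \<and> card (Q i) \<le> c" if "i < n" for i
          using C(1,2) Q(1)[OF that] small dW by blast
        show "Q i \<inter> Q j = {} \<and> (\<forall>q \<in> Q i. \<forall>r \<in> Q j. \<not> E q r)" if "i < n" "j < n" "i \<noteq> j" for i j
          using C(3)[OF Q(1)[OF that(1)] Q(1)[OF that(2)] Q(2)[OF that]] .
        show "E z r" if "i < n" "j < n" "i \<noteq> j" "z \<notin> Q i" "E d z" "q \<in> Q i" "E z q" "r \<in> Q j" for i j z q r
        proof -
          have qr: "q \<in> W" "r \<in> W" using C(1) Q(1) that by blast+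
          \<comment> \<open>Inside \<open>W\<close>, a neighbour of a vertex of \<open>Q i\<close>
            lies in \<open>Q i\<close>; hence the module property of \<open>W\<close> applies to
            \<open>z\<close>.\<close>
          have "z \<notin> W"
          proof
            assume "z \<in> W"
            then obtain R where "R \<in> \<C>" "z \<in> R" using C(1) by blast
            then show False using C(3)[of R "Q i"] Q(1)[OF that(1)] that by blast
          qed
          then show ?thesis using mod that qr by blast
        qed
      qed
    qed
    have "card W \<le> (\<Sum>Q\<in>\<C>. card Q)" using C(1) card_Union_le_sum_card[of \<C>] by simp
    also have "\<dots> \<le> card \<C> * c" using sum_bounded_above[of \<C> card c] small by simp
    also have "\<dots> \<le> n * c" using \<open>card \<C> < n\<close> by simp
    finally show "card W \<le> n * c" .
  qed
qed

section \<open>Bounded degree and bounded order\<close>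

text \<open>A whole neighbourhood is trivially a module of itself, and its cliques have at most
  \<open>k\<close> vertices.\<close>

lemma bounded_degree:
  "\<exists>b::nat. \<forall>V (E :: 'a \<Rightarrow> 'a \<Rightarrow> bool) d. critical_graph k V E \<longrightarrow> card {w. E d w} \<le> b"
proof -
  obtain b :: nat where b: "\<forall>V (E :: 'a \<Rightarrow> 'a \<Rightarrow> bool) d W. critical_graph k V E \<longrightarrow> (\<forall>w\<in>W. E d w) \<longrightarrow>
    (\<forall>z v w. z \<notin> W \<longrightarrow> E d z \<longrightarrow> v \<in> W \<longrightarrow> E z v \<longrightarrow> w \<in> W \<longrightarrow> E z w) \<longrightarrow>
    (\<forall>K. K \<subseteq> W \<longrightarrow> (\<forall>x\<in>K. \<forall>y\<in>K. x \<noteq> y \<longrightarrow> E x y) \<longrightarrow> card K \<le> k) \<longrightarrow> card W \<le> b"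
    using bounded_modules[of k k] ..
  show ?thesis
  proof (intro exI[of _ b] allI impI)
    fix V and E :: "'a \<Rightarrow> 'a \<Rightarrow> bool" and d
    assume crit: "critical_graph k V E"
    interpret critical_graph k V E by fact
    show "card {w. E d w} \<le> b"
    proof (rule b[rule_format, OF crit, of "{w. E d w}" d])
      fix K assume "K \<subseteq> {w. E d w}" "\<And>x y. x \<in> K \<Longrightarrow> y \<in> K \<Longrightarrow> x \<noteq> y \<Longrightarrow> E x y"
      then show "card K \<le> k" using card_clique[of K] E_in_V' by blast
    qed simp_all
  qed
qed

text \<open>Three closed neighbourhoods in succession give the ball of radius three about
  \<open>d\<close>. An edge \<open>p q\<close> leaving it would complete a shortest path
  \<open>d\<close>, \<open>s\<close>, \<open>r\<close>, \<open>p\<close>, \<open>q\<close>, which is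
  an induced \<open>P\<^sub>5\<close>.\<close>

lemma (in critical_graph) card_vertices:
  assumes deg: "\<And>d. card {w. E d w} \<le> b"
  shows "card V \<le> (b + 1) ^ 3"
proof (cases "V = {}")
  case False
  then obtain d where d: "d \<in> V" by blast
  define N where "N S = (\<Union>s\<in>S. insert s {w. E s w})" for S
  have NV: "N S \<subseteq> V" if "S \<subseteq> V" for S using that E_in_V' by (auto simp: N_def)
  have cardN: "card (N S) \<le> card S * (b + 1)" if "S \<subseteq> V" for S
  proof -
    have fin: "finite S" using that finite_V finite_subset by blast
    have "card (N S) \<le> (\<Sum>s\<in>S. card (insert s {w. E s w}))"
      unfolding N_def using fin by (rule card_UN_le)
    also have "\<dots> \<le> (\<Sum>s\<in>S. b + 1)"
    proof (rule sum_mono)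
      fix s
      have "{w. E s w} \<subseteq> V" using E_in_V' by blast
      then have "finite {w. E s w}" using finite_V by (rule finite_subset)
      then show "card (insert s {w. E s w}) \<le> b + 1" using deg[of s] by (simp add: card_insert_if)
    qed
    finally show ?thesis by simp
  qed
  let ?B1 = "N {d}" let ?B2 = "N ?B1" let ?B3 = "N ?B2"
  have sub: "?B1 \<subseteq> V" "?B2 \<subseteq> V" "?B3 \<subseteq> V" using NV d by auto
  have "V = ?B3"
  proof (rule ccontr)
    assume "V \<noteq> ?B3"
    then have "V - ?B3 \<noteq> {}" using sub(3) by blast
    moreover have "?B3 \<noteq> {}" by (auto simp: N_def)
    ultimately obtain p q where pq: "p \<in> ?B3" "q \<in> V - ?B3" "E p q"
      using connected[of ?B3 "V - ?B3"] sub(3) by blast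
    have inN: "w \<in> N S" if "s \<in> S" "E s w" for s w S using that by (auto simp: N_def)
    have self: "S \<subseteq> N S" for S by (auto simp: N_def)
    have "p \<notin> ?B2" using pq inN by blast
    then obtain r where r: "r \<in> ?B2" "E r p" using pq(1) by (auto simp: N_def)
    have "r \<notin> ?B1" using r \<open>p \<notin> ?B2\<close> inN by blast
    then obtain s where s: "s \<in> ?B1" "E s r" using r(1) by (auto simp: N_def)
    have "s \<noteq> d" using s \<open>r \<notin> ?B1\<close> inN by blast
    then have "E d s" using s(1) by (auto simp: N_def)
    moreover have "\<not> E s p" using inN[OF s(1)] \<open>p \<notin> ?B2\<close> by blast
    moreover have "\<not> E d r" "\<not> E d p" "\<not> E d q" "\<not> E s q" "\<not> E r q"
      using inN self \<open>r \<notin> ?B1\<close> \<open>p \<notin> ?B2\<close> pq(2) s(1) r(1) by blast+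
    ultimately show False using no_P5[of d s r p q] s(2) r(2) pq(3) by blast
  qed
  then have "card V = card ?B3" by simp
  also have "\<dots> \<le> card ?B2 * (b + 1)" by (rule cardN[OF sub(2)])
  also have "\<dots> \<le> card ?B1 * (b + 1) * (b + 1)" by (intro mult_le_mono1 cardN[OF sub(1)])
  also have "\<dots> \<le> card {d} * (b + 1) * (b + 1) * (b + 1)"
    using d by (intro mult_le_mono1 cardN) simp
  also have "\<dots> = (b + 1) ^ 3" by (simp add: power3_eq_cube del: mult_Suc mult_Suc_right)
  finally show ?thesis .
qed simp

section \<open>Vertex-critical graphs and isomorphism classes\<close>

text \<open>The subgraph induced on the image of \<open>g\<close> is the required copy.\<close>

lemma contains_induced_pair_graphI:
  assumes G: "pair_graph G" and F: "pair_graph F" and inj: "inj_on g (pverts F)" "g ` pverts F \<subseteq> pverts G"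
    and iff: "\<And>u v. u \<in> pverts F \<Longrightarrow> v \<in> pverts F \<Longrightarrow> (u, v) \<in> parcs F \<longleftrightarrow> (g u, g v) \<in> parcs G"
  shows "contains_induced (with_proj G) (with_proj F)"
proof -
  interpret G: pair_graph G by fact
  interpret F: pair_graph F by fact
  let ?S = "g ` pverts F"
  define H where "H = \<lparr>pverts = ?S, parcs = parcs G \<inter> ?S \<times> ?S\<rparr>"
  have sym: "(u, v) \<in> parcs G \<Longrightarrow> (v, u) \<in> parcs G" for u v
    using G.pair_sym_arcs by (auto simp: symmetric_def dest: symD)
  have H: "pair_graph H"
    using G.pair_no_loops sym G.pair_finite_arcs F.pair_finite_verts
    by unfold_locales (auto simp: H_def symmetric_def intro: symI)
  interpret H: pair_graph H by fact
  have "induced_subgraph (with_proj H) (with_proj G)"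
    using inj(2) G.pair_wf_digraph[folded wf_digraph_wp_iff] H.pair_wf_digraph[folded wf_digraph_wp_iff]
    by (auto simp: induced_subgraph_def subgraph_def compatible_def H_def)
  moreover have "digraph_iso (with_proj F) (with_proj H)"
    unfolding digraph_iso_pair_graph_iff[OF F H]
    using inj(1) iff by (intro exI[of _ g]) (auto simp: H_def bij_betw_def)
  ultimately show ?thesis unfolding contains_induced_def by blast
qed

lemma colorable_with_proj:
  "colorable (with_proj G) n \<longleftrightarrow>
    (\<exists>c. (\<forall>v \<in> pverts G. c v < n) \<and> (\<forall>u v. (u, v) \<in> parcs G \<longrightarrow> c u \<noteq> c v))"
  unfolding colorable_def image_subset_iff by (simp add: Ball_def split_paired_All)

lemma colorable_del_vert:
  "colorable (pre_digraph.del_vert (with_proj G) x) n \<longleftrightarrow>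
    (\<exists>c. (\<forall>v \<in> pverts G - {x}. c v < n) \<and>
      (\<forall>u v. (u, v) \<in> parcs G \<longrightarrow> u \<noteq> x \<longrightarrow> v \<noteq> x \<longrightarrow> c u \<noteq> c v))"
proof -
  have "arcs_ends (pre_digraph.del_vert (with_proj G) x) = {(u, v) \<in> parcs G. u \<noteq> x \<and> v \<noteq> x}"
    by (auto simp: arcs_ends_def arc_to_ends_def pre_digraph.del_vert_def)
  moreover have "verts (pre_digraph.del_vert (with_proj G) x) = pverts G - {x}"
    by (simp add: pre_digraph.del_vert_def)
  ultimately show ?thesis
    unfolding colorable_def image_subset_iff by (simp add: Ball_def split_paired_All imp_conjL)
qed

text \<open>Converts chromatic numbers into existence and non-existence of colourings;
  \<open>k > 0\<close> makes \<open>k - 1\<close> a smaller number of colours.\<close>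

lemma vertex_critical_colorings:
  assumes "pair_graph G" "vertex_critical k (with_proj G)" "k > 0"
  shows "colorable (with_proj G) k" "\<not> colorable (with_proj G) (k - 1)"
    and "v \<in> pverts G \<Longrightarrow> colorable (pre_digraph.del_vert (with_proj G) v) (k - 1)"
proof -
  interpret pair_graph G by fact
  have k: "(LEAST n. colorable (with_proj G) n) = k"
    using assms(2) by (simp add: vertex_critical_def chromatic_number_def)
  have "digraph (with_proj G)" by unfold_locales
  then have "\<exists>n. colorable (with_proj G) n" using colorable_card by blast
  then show c: "colorable (with_proj G) k" using LeastI_ex k by metis
  show "\<not> colorable (with_proj G) (k - 1)"
    using not_less_Least[of "k - 1" "colorable (with_proj G)"] k assms(3) by simp
  show "colorable (pre_digraph.del_vert (with_proj G) v) (k - 1)" if "v \<in> pverts G"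
  proof -
    let ?D = "pre_digraph.del_vert (with_proj G) v"
    \<comment> \<open>\<open>LeastI\<close> needs some number of colours that suffices for the
      deleted graph.\<close>
    have "colorable ?D k" using c unfolding colorable_with_proj colorable_del_vert by blast
    then have "colorable ?D (chromatic_number ?D)"
      unfolding chromatic_number_def by (rule LeastI)
    moreover have "chromatic_number ?D \<le> k - 1"
      using assms(2) that by (auto simp: vertex_critical_def)
    ultimately show ?thesis
      unfolding colorable_del_vert using less_le_trans by blast
  qed
qed

text \<open>A proper colouring is injective on cliques, whence the clique bound. Failure of either
  of the last two axioms would allow a colouring with \<open>k - 1\<close> colours to be assembled
  from colourings of vertex-deleted subgraphs.\<close>

lemma critical_graph_of_vertex_critical:
  assumes G: "pair_graph G" and crit: "vertex_critical k (with_proj G)" and free: "P5_gem_free G" and k: "k > 0"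
  shows "critical_graph k (pverts G) (\<lambda>u v. (u, v) \<in> parcs G)"
proof -
  interpret pair_graph G by fact
  note col = vertex_critical_colorings[OF G crit k]
  have sym: "(u, v) \<in> parcs G \<Longrightarrow> (v, u) \<in> parcs G" for u v
    using pair_sym_arcs by (auto simp: symmetric_def dest: symD)
  have irr: "(u, u) \<notin> parcs G" for u using pair_no_loops[of "(u, u)"] by auto
  have no_coloring: False
    if "\<And>v. v \<in> pverts G \<Longrightarrow> c v < k - 1" "\<And>u v. (u, v) \<in> parcs G \<Longrightarrow> c u \<noteq> c v" for c
    using col(2) that unfolding colorable_with_proj by blast
  have coloring: "\<exists>c. (\<forall>v \<in> pverts G - {x}. c v < k - 1) \<and>
      (\<forall>u v. (u, v) \<in> parcs G \<longrightarrow> u \<noteq> x \<longrightarrow> v \<noteq> x \<longrightarrow> c u \<noteq> c v)" if "x \<in> pverts G" for x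
    using col(3)[OF that] unfolding colorable_del_vert .
  show ?thesis
  proof
    show "finite (pverts G)" by (rule pair_finite_verts)
    show "u \<in> pverts G" if "(u, v) \<in> parcs G" for u v using that by (rule in_arcsD1)
    show "(v, u) \<in> parcs G" if "(u, v) \<in> parcs G" for u v using that by (rule sym)
    show "(u, u) \<notin> parcs G" for u by (rule irr)
  next
    fix p q r s t
    assume e: "(p, q) \<in> parcs G" "(q, r) \<in> parcs G" "(r, s) \<in> parcs G" "(s, t) \<in> parcs G"
      and n: "(p, r) \<notin> parcs G" "(p, s) \<notin> parcs G" "(p, t) \<notin> parcs G"
        "(q, s) \<notin> parcs G" "(q, t) \<notin> parcs G" "(r, t) \<notin> parcs G"
    have adj: "(q, p) \<in> parcs G" "(r, q) \<in> parcs G" "(s, r) \<in> parcs G" "(t, s) \<in> parcs G"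
      using e by (simp_all add: sym)
    have non: "(r, p) \<notin> parcs G" "(s, p) \<notin> parcs G" "(t, p) \<notin> parcs G"
      "(s, q) \<notin> parcs G" "(t, q) \<notin> parcs G" "(t, r) \<notin> parcs G"
      using n sym by blast+
    have "contains_induced (with_proj G) (with_proj (path_graph 5))"
    proof (rule contains_induced_pair_graphI[OF G pair_graph_path_graph, of "(!) [p, q, r, s, t]"])
      have five: "{..<5} = {0, 1, 2, 3, 4 :: nat}" by auto
      \<comment> \<open>The pattern of edges and non-edges alone forces distinctness.\<close>
      have dist: "p \<noteq> q" "p \<noteq> r" "p \<noteq> s" "p \<noteq> t" "q \<noteq> r" "q \<noteq> s" "q \<noteq> t" "r \<noteq> s" "r \<noteq> t" "s \<noteq> t"
        using e n irr sym by blast+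
      show "inj_on ((!) [p, q, r, s, t]) (pverts (path_graph 5))"
        using dist by (auto simp: path_graph_def five)
      show "(!) [p, q, r, s, t] ` pverts (path_graph 5) \<subseteq> pverts G"
        using e in_arcsD1 in_arcsD2 by (auto simp: path_graph_def five)
      have "pverts (path_graph 5) = {0, 1, 2, 3, 4}" by (simp add: path_graph_def five)
      then have "\<forall>u \<in> pverts (path_graph 5). \<forall>v \<in> pverts (path_graph 5). (u, v) \<in> parcs (path_graph 5) \<longleftrightarrow>
          ([p, q, r, s, t] ! u, [p, q, r, s, t] ! v) \<in> parcs G"
        by (simp add: path_graph_def e n adj non irr)
      then show "(u, v) \<in> parcs (path_graph 5) \<longleftrightarrow> ([p, q, r, s, t] ! u, [p, q, r, s, t] ! v) \<in> parcs G"
        if "u \<in> pverts (path_graph 5)" "v \<in> pverts (path_graph 5)" for u v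
        using that by simp
    qed
    then show False using free by (simp add: P5_gem_free_def)
  next
    fix z p q r s
    assume z: "(z, p) \<in> parcs G" "(z, q) \<in> parcs G" "(z, r) \<in> parcs G" "(z, s) \<in> parcs G"
      and e: "(p, q) \<in> parcs G" "(q, r) \<in> parcs G" "(r, s) \<in> parcs G"
      and n: "(p, r) \<notin> parcs G" "(p, s) \<notin> parcs G" "(q, s) \<notin> parcs G"
    have adj: "(p, z) \<in> parcs G" "(q, z) \<in> parcs G" "(r, z) \<in> parcs G" "(s, z) \<in> parcs G"
      "(q, p) \<in> parcs G" "(r, q) \<in> parcs G" "(s, r) \<in> parcs G"
      using z e by (simp_all add: sym)
    have non: "(r, p) \<notin> parcs G" "(s, p) \<notin> parcs G" "(s, q) \<notin> parcs G"
      using n sym by blast+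
    have "contains_induced (with_proj G) (with_proj gem)"
    \<comment> \<open>The hub \<open>z\<close> comes last since it plays the vertex 4 of
      \<open>gem\<close>.\<close>
    proof (rule contains_induced_pair_graphI[OF G pair_graph_gem, of "(!) [p, q, r, s, z]"])
      have four: "{..<4} = {0, 1, 2, 3 :: nat}" by auto
      have dist: "p \<noteq> q" "p \<noteq> r" "p \<noteq> s" "p \<noteq> z" "q \<noteq> r" "q \<noteq> s" "q \<noteq> z" "r \<noteq> s" "r \<noteq> z" "s \<noteq> z"
        using z e n irr sym by blast+
      show "inj_on ((!) [p, q, r, s, z]) (pverts gem)"
        using dist by (auto simp: gem_def path_graph_def four)
      show "(!) [p, q, r, s, z] ` pverts gem \<subseteq> pverts G"
        using z in_arcsD1 in_arcsD2 by (auto simp: gem_def path_graph_def four)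
      have "pverts gem = {4, 0, 1, 2, 3}" by (simp add: gem_def path_graph_def four)
      then have "\<forall>u \<in> pverts gem. \<forall>v \<in> pverts gem. (u, v) \<in> parcs gem \<longleftrightarrow>
          ([p, q, r, s, z] ! u, [p, q, r, s, z] ! v) \<in> parcs G"
        by (simp add: gem_def path_graph_def z e n adj non irr)
      then show "(u, v) \<in> parcs gem \<longleftrightarrow> ([p, q, r, s, z] ! u, [p, q, r, s, z] ! v) \<in> parcs G"
        if "u \<in> pverts gem" "v \<in> pverts gem" for u v
        using that by simp
    qed
    then show False using free by (simp add: P5_gem_free_def)
  next
    fix K assume K: "K \<subseteq> pverts G" "\<And>x y. x \<in> K \<Longrightarrow> y \<in> K \<Longrightarrow> x \<noteq> y \<Longrightarrow> (x, y) \<in> parcs G"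
    obtain c where c: "\<forall>v \<in> pverts G. c v < k" "\<forall>u v. (u, v) \<in> parcs G \<longrightarrow> c u \<noteq> c v"
      using col(1) unfolding colorable_with_proj by blast
    have "inj_on c K" using K(2) c(2) by (meson inj_onI)
    moreover have "c ` K \<subseteq> {..<k}" using K(1) c(1) by auto
    ultimately show "card K \<le> k" using card_inj_on_le[of c K "{..<k}"] by simp
  next
    fix A B assume AB: "A \<union> B = pverts G" "A \<inter> B = {}" "A \<noteq> {}" "B \<noteq> {}"
    show "\<exists>a\<in>A. \<exists>b\<in>B. (a, b) \<in> parcs G"
    proof (rule ccontr)
      assume no: "\<not> ?thesis"
      obtain a b where ab: "a \<in> A" "b \<in> B" using AB by blast
      have "a \<in> pverts G" "b \<in> pverts G" using ab AB(1) by auto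
      \<comment> \<open>Each side takes the colouring whose deleted vertex lies on the other side,
        so the two glue to a colouring of the whole graph.\<close>
      from coloring[OF this(2)] coloring[OF this(1)] obtain c c' where c: "\<forall>v \<in> pverts G - {b}. c v < k - 1"
          "\<forall>u v. (u, v) \<in> parcs G \<longrightarrow> u \<noteq> b \<longrightarrow> v \<noteq> b \<longrightarrow> c u \<noteq> c v"
        and c': "\<forall>v \<in> pverts G - {a}. c' v < k - 1"
          "\<forall>u v. (u, v) \<in> parcs G \<longrightarrow> u \<noteq> a \<longrightarrow> v \<noteq> a \<longrightarrow> c' u \<noteq> c' v"
        by (elim exE conjE)
      show False
      proof (rule no_coloring[of "\<lambda>v. if v \<in> A then c v else c' v"])
        show "(if v \<in> A then c v else c' v) < k - 1" if "v \<in> pverts G" for v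
          using that c(1) c'(1) ab AB(2) by (auto split: if_splits)
        fix u v assume uv: "(u, v) \<in> parcs G"
        then have "u \<in> A \<union> B" "v \<in> A \<union> B" using in_arcsD1 in_arcsD2 AB(1) by blast+
        then have "u \<in> A \<and> v \<in> A \<or> u \<in> B \<and> v \<in> B" using no uv sym by blast
        then show "(if u \<in> A then c u else c' u) \<noteq> (if v \<in> A then c v else c' v)"
          using uv c(2) c'(2) ab AB(2) by (metis disjoint_iff)
      qed
    qed
  next
    fix A f
    assume A: "A \<subseteq> pverts G" "A \<noteq> {}" "f ` A \<subseteq> pverts G - A"
      and hom: "\<And>a b. a \<in> A \<Longrightarrow> b \<in> A \<Longrightarrow> (a, b) \<in> parcs G \<Longrightarrow> (f a, f b) \<in> parcs G"
    show "\<exists>a\<in>A. \<exists>z. z \<notin> A \<and> (a, z) \<in> parcs G \<and> (f a, z) \<notin> parcs G"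
    proof (rule ccontr)
      assume no: "\<not> ?thesis"
      obtain x where x: "x \<in> A" using A(2) by blast
      then obtain c where c: "\<forall>v \<in> pverts G - {x}. c v < k - 1"
        "\<forall>u v. (u, v) \<in> parcs G \<longrightarrow> u \<noteq> x \<longrightarrow> v \<noteq> x \<longrightarrow> c u \<noteq> c v"
        using coloring A(1) by blast
      have c2: "c u \<noteq> c v" if "(u, v) \<in> parcs G" "u \<notin> A" "v \<notin> A" for u v
        using c(2) that x by blast
      have fA: "f a \<notin> A" "f a \<in> pverts G" if "a \<in> A" for a using A(3) that by blast+
      \<comment> \<open>\<open>r\<close> retracts the graph onto the complement of \<open>A\<close>.
        The negated conclusion makes it a homomorphism, so \<open>c\<close>, which is proper there
        because \<open>x \<in> A\<close>, pulls back to the whole graph.\<close>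
      define r where "r v = (if v \<in> A then f v else v)" for v
      have r: "r v \<notin> A" "v \<in> pverts G \<Longrightarrow> r v \<in> pverts G" for v using fA by (auto simp: r_def)
      have r_hom: "(r u, r v) \<in> parcs G" if uv: "(u, v) \<in> parcs G" for u v
        using hom[of u v] uv sym[OF uv] no sym unfolding r_def by auto
      show False
      proof (rule no_coloring[of "\<lambda>v. c (r v)"])
        show "c (r v) < k - 1" if "v \<in> pverts G" for v
          using c(1) r[of v] that x by auto
        show "c (r u) \<noteq> c (r v)" if "(u, v) \<in> parcs G" for u v
          using c2[OF r_hom[OF that]] r by blast
      qed
    qed
  qed
qed

section \<open>Isomorphism classes of graphs of bounded order\<close>

text \<open>Numbering the vertices turns each graph into a \<open>code\<close> on an initial segment
  of the natural numbers. There are finitely many codes, and equal codes imply isomorphism, although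
  the family itself may be infinite.\<close>

lemma finite_pair_graph_iso_classes:
  fixes \<G> :: "'a pair_pre_digraph set"
  assumes \<G>: "\<And>G. G \<in> \<G> \<Longrightarrow> pair_graph G \<and> card (pverts G) \<le> n"
  shows "finite (\<G> // pair_graph_iso)"
proof -
  have "\<exists>f. bij_betw f (pverts G) {..<card (pverts G)}" if "G \<in> \<G>" for G
  proof -
    interpret pair_graph G using \<G>[OF that] by simp
    show ?thesis using ex_bij_betw_finite_nat[OF pair_finite_verts] by (simp add: atLeast0LessThan)
  qed
  then obtain f where f: "\<And>G. G \<in> \<G> \<Longrightarrow> bij_betw (f G) (pverts G) {..<card (pverts G)}" by metis
  define code where "code G = (card (pverts G), map_prod (f G) (f G) ` parcs G)" for G
  have in_arcs: "u \<in> pverts G \<and> v \<in> pverts G" if "G \<in> \<G>" "(u, v) \<in> parcs G" for G u v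
  proof -
    interpret pair_graph G using \<G>[OF that(1)] by simp
    show ?thesis using that(2) in_arcsD1 in_arcsD2 by blast
  qed
  have "code ` \<G> \<subseteq> {..n} \<times> Pow ({..<n} \<times> {..<n})"
  proof
    fix x assume "x \<in> code ` \<G>"
    then obtain G where G: "G \<in> \<G>" "x = code G" by blast
    have "f G v < n" if "v \<in> pverts G" for v
      using bij_betwE[OF f[OF G(1)]] \<G>[OF G(1)] that by fastforce
    then show "x \<in> {..n} \<times> Pow ({..<n} \<times> {..<n})"
      using in_arcs[OF G(1)] \<G>[OF G(1)] by (auto simp: G(2) code_def)
  qed
  then have "finite (code ` \<G>)" by (rule finite_subset) simp
  have iso: "(G, H) \<in> pair_graph_iso" if G: "G \<in> \<G>" and H: "H \<in> \<G>" and eq: "code G = code H" for G H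
  proof -
    \<comment> \<open>A vertex of \<open>G\<close> goes to the vertex of \<open>H\<close> with the
      same number.\<close>
    define g where "g = inv_into (pverts H) (f H) \<circ> f G"
    have card: "card (pverts G) = card (pverts H)" using eq by (simp add: code_def)
    have g: "bij_betw g (pverts G) (pverts H)"
      unfolding g_def using bij_betw_trans[OF f[OF G]] bij_betw_inv_into[OF f[OF H]] card by metis
    have fg: "f H (g v) = f G v" if "v \<in> pverts G" for v
      unfolding g_def using bij_betw_inv_into_right[OF f[OF H]] bij_betwE[OF f[OF G]] that card by simp
    have code_arc: "(u, v) \<in> parcs K \<longleftrightarrow> (f K u, f K v) \<in> snd (code K)"
      if K: "K \<in> \<G>" "u \<in> pverts K" "v \<in> pverts K" for K u v
    proof
      assume "(f K u, f K v) \<in> snd (code K)"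
      then obtain a b where "(a, b) \<in> parcs K" "f K u = f K a" "f K v = f K b"
        by (auto simp: code_def)
      then show "(u, v) \<in> parcs K"
        using in_arcs[OF K(1)] K f[OF K(1)] by (metis bij_betw_inv_into_left)
    qed (auto simp: code_def)
    have "(u, v) \<in> parcs G \<longleftrightarrow> (g u, g v) \<in> parcs H" if "u \<in> pverts G" "v \<in> pverts G" for u v
      using code_arc[OF G that] code_arc[OF H, of "g u" "g v"] bij_betwE[OF g] that fg eq by simp
    then show ?thesis
      using g \<G>[OF G] \<G>[OF H] by (auto simp: pair_graph_iso_def digraph_iso_pair_graph_iff)
  qed
  have "\<G> // pair_graph_iso = (\<lambda>G. pair_graph_iso `` {G}) ` \<G>"
    by (auto simp: quotient_def)
  \<comment> \<open>Every class is the class of the graph chosen for its code.\<close>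
  also have "\<dots> \<subseteq> (\<lambda>x. pair_graph_iso `` {inv_into \<G> code x}) ` code ` \<G>"
  proof
    fix X assume "X \<in> (\<lambda>G. pair_graph_iso `` {G}) ` \<G>"
    then obtain G where G: "G \<in> \<G>" "X = pair_graph_iso `` {G}" by blast
    let ?H = "inv_into \<G> code (code G)"
    have "?H \<in> \<G>" "code ?H = code G" using G(1) by (simp_all add: inv_into_into f_inv_into_f)
    then have "X = pair_graph_iso `` {?H}"
      using equiv_class_eq[OF equiv_pair_graph_iso iso] G by metis
    then show "X \<in> (\<lambda>x. pair_graph_iso `` {inv_into \<G> code x}) ` code ` \<G>" using G(1) by blast
  qed
  finally show ?thesis using \<open>finite (code ` \<G>)\<close> finite_subset by blast
qed

theorem theorem2p10:
  fixes k :: nat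
  assumes "k > 0"
  shows "finite ({G :: 'a pair_pre_digraph. pair_graph G \<and> vertex_critical k G \<and> P5_gem_free G}
           // pair_graph_iso)"
proof -
  \<comment> \<open>\<open>b\<close> is fixed before the graph, so one bound on the order serves the
    whole family.\<close>
  obtain b :: nat where b: "\<forall>V (E :: 'a \<Rightarrow> 'a \<Rightarrow> bool) d. critical_graph k V E \<longrightarrow> card {w. E d w} \<le> b"
    using bounded_degree[of k] ..
  show ?thesis
  proof (rule finite_pair_graph_iso_classes[of _ "(b + 1) ^ 3"])
    fix G :: "'a pair_pre_digraph"
    assume "G \<in> {G. pair_graph G \<and> vertex_critical k G \<and> P5_gem_free G}"
    then have G: "pair_graph G" "vertex_critical k G" "P5_gem_free G" by simp_all
    interpret critical_graph k "pverts G" "\<lambda>u v. (u, v) \<in> parcs G"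
      using critical_graph_of_vertex_critical[OF G assms] .
    have "card {w. (d, w) \<in> parcs G} \<le> b" for d
      using b critical_graph_axioms by blast
    then show "pair_graph G \<and> card (pverts G) \<le> (b + 1) ^ 3"
      using card_vertices G(1) by blast
  qed
qed

end
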